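(* Let $\underline{A}=(A_1,\dots,A_k)\in {\rm Mat}^+_2(\mathbb{R})^k$ be a locally constant linear cocycle over a fixed Bernoulli or (primitive) Markov shift on the alphabet $\{1,\dots,k\}$, and assume that at least one component $A_i$ is singular and at least one component $A_j$ is invertible. Then either $\underline{A}$ is projectively uniformly hyperbolic, or else there is a sequence of cocycles $\underline{A}_n\in{\rm Mat}^+_2(\mathbb{R})^k$ with $\underline{A}_n\to\underline{A}$ and $L_1(\underline{A}_n)=-\infty$ for all $n\in\mathbb{N}$.
   Context: ${\rm Mat}^+_2(\mathbb{R})$ denotes the set of real $2\times 2$ matrices $g$ with $\det g\ge 0$. Let $\mathscr{A}=\{1,\dots,k\}$. The base dynamics is either a Bernoulli shift: $X=\mathscr{A}^{\mathbb{Z}}$ with product measure $\mu=p^{\mathbb{Z}}$, $p$ a probability vector with all $p_i>0$; or a Markov shift: $P=(p_{ij})$ is a primitive $k\times k$ matrix with nonnegative entries whose columns sum to $1$ ($p_{ij}$ is the probability of the transition $j\to i$, which is called admissible if $p_{ij}>0$), $q=Pq$ is the stationary probability vector, $X$ is the set of sequences $\omega\in\mathscr{A}^{\mathbb{Z}}$ with $p_{\omega_{n+1}\omega_n}>0$ for all $n$, and $\mu$ is the Markov measure with $\mu(\{\omega:\omega_{m+l}=i_l,\ 0\le l\le n\})=q_{i_0}p_{i_1i_0}\cdots p_{i_ni_{n-1}}$. In both cases $\sigma$ is the left shift $(\sigma\omega)_n=\omega_{n+1}$. A tuple $\underline A=(A_1,\dots,A_k)$ of real $2\times2$ matrices defines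 the cocycle $F(\omega,v)=(\sigma\omega,A_{\omega_1}v)$ on $X\times\mathbb{R}^2$, with iterates $A^n(\omega)=A_{\omega_n}\cdots A_{\omega_1}$; its first Lyapunov exponent is the $\mu$-a.e. constant limit $L_1(\underline A)=\lim_{n\to\infty}\frac1n\log\|A^n(\omega)\|\in[-\infty,\infty)$. The cocycle is projectively uniformly hyperbolic if there are continuous maps $\omega\mapsto E_0(\omega),E_1(\omega)$ from $X$ to one-dimensional subspaces of $\mathbb{R}^2$ with $\mathbb{R}^2=E_0(\omega)\oplus E_1(\omega)$, invariant under the cocycle ($A_{\omega_1}E_j(\omega)\subseteq E_j(\sigma\omega)$), and some $n\in\mathbb{N}$ with $\|A^n(\omega)|_{E_0(\omega)}\|<\|A^n(\omega)|_{E_1(\omega)}\|$ for all $\omega\in X$. *)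

theory Defs
  imports "HOL-Probability.Probability"
begin

definition shift :: "(int \<Rightarrow> nat) \<Rightarrow> (int \<Rightarrow> nat)" where
  "shift \<omega> = (\<lambda>n. \<omega> (n + 1))"

definition seq_space :: "(int \<Rightarrow> nat) measure" where
  "seq_space = PiM UNIV (\<lambda>_. count_space UNIV)"

fun mat_pow_entry :: "nat \<Rightarrow> (nat \<Rightarrow> nat \<Rightarrow> real) \<Rightarrow> nat \<Rightarrow> nat \<Rightarrow> nat \<Rightarrow> real" where
  "mat_pow_entry k P 0 i j = (if i = j then 1 else 0)"
| "mat_pow_entry k P (Suc N) i j = (\<Sum>l\<in>{1..k}. P i l * mat_pow_entry k P N l j)"

definition primitive_matrix :: "nat \<Rightarrow> (nat \<Rightarrow> nat \<Rightarrow> real) \<Rightarrow> bool" where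
  "primitive_matrix k P \<longleftrightarrow>
     (\<forall>i\<in>{1..k}. \<forall>j\<in>{1..k}. P i j \<ge> 0) \<and>
     (\<exists>N\<ge>1. \<forall>i\<in>{1..k}. \<forall>j\<in>{1..k}. mat_pow_entry k P N i j > 0)"

text \<open>Bernoulli shift: X = full shift, mu = product measure p^Z (characterised by cylinders).\<close>
definition bernoulli_shift ::
  "nat \<Rightarrow> (nat \<Rightarrow> real) \<Rightarrow> (int \<Rightarrow> nat) set \<Rightarrow> (int \<Rightarrow> nat) measure \<Rightarrow> bool" where
  "bernoulli_shift k p X \<mu> \<longleftrightarrow>
     (\<forall>i\<in>{1..k}. p i > 0) \<and> (\<Sum>i\<in>{1..k}. p i) = 1 \<and>
     X = {\<omega>. \<forall>n. \<omega> n \<in> {1..k}} \<and>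
     prob_space \<mu> \<and> sets \<mu> = sets seq_space \<and> space \<mu> = space seq_space \<and>
     (\<forall>(m::int) (n::nat) (w::nat \<Rightarrow> nat). (\<forall>l\<le>n. w l \<in> {1..k}) \<longrightarrow>
        measure \<mu> {\<omega> \<in> space \<mu>. \<forall>l\<le>n. \<omega> (m + int l) = w l} = (\<Prod>l\<in>{0..n}. p (w l)))"

text \<open>Markov shift: P column-stochastic primitive, q = Pq stationary probability vector,
  p_{ij} is the probability of the transition j -> i.\<close>
definition markov_shift ::
  "nat \<Rightarrow> (nat \<Rightarrow> nat \<Rightarrow> real) \<Rightarrow> (nat \<Rightarrow> real) \<Rightarrow> (int \<Rightarrow> nat) set \<Rightarrow> (int \<Rightarrow> nat) measure \<Rightarrow> bool" where
  "markov_shift k P q X \<mu> \<longleftrightarrow>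
     primitive_matrix k P \<and>
     (\<forall>j\<in>{1..k}. (\<Sum>i\<in>{1..k}. P i j) = 1) \<and>
     (\<forall>i\<in>{1..k}. q i \<ge> 0) \<and> (\<Sum>i\<in>{1..k}. q i) = 1 \<and>
     (\<forall>i\<in>{1..k}. q i = (\<Sum>j\<in>{1..k}. P i j * q j)) \<and>
     X = {\<omega>. (\<forall>n. \<omega> n \<in> {1..k}) \<and> (\<forall>n. P (\<omega> (n + 1)) (\<omega> n) > 0)} \<and>
     prob_space \<mu> \<and> sets \<mu> = sets seq_space \<and> space \<mu> = space seq_space \<and>
     (\<forall>(m::int) (n::nat) (w::nat \<Rightarrow> nat). (\<forall>l\<le>n. w l \<in> {1..k}) \<longrightarrow>
        measure \<mu> {\<omega> \<in> space \<mu>. \<forall>l\<le>n. \<omega> (m + int l) = w l}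
          = q (w 0) * (\<Prod>l\<in>{1..n}. P (w l) (w (l - 1))))"

fun cocycle_iter :: "(nat \<Rightarrow> real^2^2) \<Rightarrow> (int \<Rightarrow> nat) \<Rightarrow> nat \<Rightarrow> real^2^2" where
  "cocycle_iter A \<omega> 0 = mat 1"
| "cocycle_iter A \<omega> (Suc n) = A (\<omega> (int (Suc n))) ** cocycle_iter A \<omega> n"

definition mnorm :: "real^2^2 \<Rightarrow> real" where
  "mnorm M = onorm (\<lambda>v. M *v v)"

definition elog :: "real \<Rightarrow> ereal" where
  "elog x = (if x = 0 then - \<infinity> else ereal (ln x))"

definition lyap1 :: "(int \<Rightarrow> nat) measure \<Rightarrow> (nat \<Rightarrow> real^2^2) \<Rightarrow> ereal" where
  "lyap1 \<mu> A = (THE c. AE \<omega> in \<mu>.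
      (\<lambda>n. elog (mnorm (cocycle_iter A \<omega> n)) / ereal (real n)) \<longlonglongrightarrow> c)"

definition line :: "(real^2) set \<Rightarrow> bool" where
  "line E \<longleftrightarrow> subspace E \<and> dim E = 1"

text \<open>Continuity of omega |-> E(omega) into the projective line, written out via local
  continuous nonvanishing spanning vector fields (product topology on int => nat).\<close>
definition continuous_line_field :: "(int \<Rightarrow> nat) set \<Rightarrow> ((int \<Rightarrow> nat) \<Rightarrow> (real^2) set) \<Rightarrow> bool" where
  "continuous_line_field X E \<longleftrightarrow>
     (\<forall>\<omega>\<in>X. line (E \<omega>)) \<and>
     (\<forall>\<omega>\<in>X. \<exists>U v. openin (top_of_set X) U \<and> \<omega> \<in> U \<and> continuous_on U v \<and>
        (\<forall>\<omega>'\<in>U. v \<omega>' \<noteq> 0 \<and> E \<omega>' = span {v \<omega>'}))"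

definition restr_norm :: "real^2^2 \<Rightarrow> (real^2) set \<Rightarrow> real" where
  "restr_norm M E = Sup {norm (M *v v) | v. v \<in> E \<and> norm v = 1}"

definition proj_unif_hyp :: "(int \<Rightarrow> nat) set \<Rightarrow> (nat \<Rightarrow> real^2^2) \<Rightarrow> bool" where
  "proj_unif_hyp X A \<longleftrightarrow>
     (\<exists>E0 E1. continuous_line_field X E0 \<and> continuous_line_field X E1 \<and>
        (\<forall>\<omega>\<in>X. {x + y | x y. x \<in> E0 \<omega> \<and> y \<in> E1 \<omega>} = UNIV \<and> E0 \<omega> \<inter> E1 \<omega> = {0}) \<and>
        (\<forall>\<omega>\<in>X. (\<lambda>v. A (\<omega> 1) *v v) ` E0 \<omega> \<subseteq> E0 (shift \<omega>)) \<and>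
        (\<forall>\<omega>\<in>X. (\<lambda>v. A (\<omega> 1) *v v) ` E1 \<omega> \<subseteq> E1 (shift \<omega>)) \<and>
        (\<exists>n::nat. \<forall>\<omega>\<in>X. restr_norm (cocycle_iter A \<omega> n) (E0 \<omega>)
                          < restr_norm (cocycle_iter A \<omega> n) (E1 \<omega>)))"

end

theory Submission
  imports Defs
begin

text \<open>
  Perturb \<open>A\<close> by rotations, \<open>A\<^sub>i\<^sup>\<theta> = R\<^sub>\<theta> A\<^sub>i\<close>, which leaves all determinants
  unchanged. If an admissible word has zero product for \<open>A\<^sup>\<theta>\<close>, that word occurs in almost every
  sequence, so \<open>L\<^sub>1(A\<^sup>\<theta>) = -\<infinity>\<close>. It remains to show that \<open>A\<close> is projectively uniformly
  hyperbolic if no admissible word has zero product for any \<open>\<bar>\<theta>\<bar> \<le> \<epsilon>\<close>.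

  Let \<open>r\<close> span the range of a singular letter, followed by invertible letters \<open>u\<close>. Since determinants are
  nonnegative, the direction \<open>A\<^sub>u\<^sup>\<theta> R\<^sub>\<theta> r\<close> turns monotonically with \<open>\<theta>\<close>, at speed at
  least one, and by hypothesis it never meets the kernel direction of a later singular letter. So it
  sweeps an arc of length less than \<open>\<pi>\<close> that stays away from that kernel. The image of
  each arc under \<open>A\<^sub>i\<close>, with both ends pushed outwards by a definite angle, is the next arc; comparing the
  invariant (Hilbert) metrics of these arcs shows that directions with a singular letter in their past
  are expanded exponentially faster than the square root of the determinant. Consequently ranges of
  past words and kernels of future words converge exponentially fast to two transversal invariant line
  fields, and the second is dominated by the first.
\<close>

section \<open>Planar linear algebra\<close>

text \<open>The determinant of the matrix with columns \<open>x\<close> and \<open>y\<close>: for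
  nonzero vectors it vanishes exactly when they are parallel, and applying a matrix multiplies it by
  the determinant.\<close>

definition wed :: "real^2 \<Rightarrow> real^2 \<Rightarrow> real" where
  "wed x y = x$1 * y$2 - x$2 * y$1"

definition circ :: "real \<Rightarrow> real^2" where
  "circ t = vector [cos t, sin t]"

definition rot :: "real \<Rightarrow> real^2^2" where
  "rot t = vector [vector [cos t, - sin t], vector [sin t, cos t]]"

lemma circ_nth [simp]: "circ t $ 1 = cos t" "circ t $ 2 = sin t"
  by (simp_all add: circ_def)

lemma rot_nth [simp]: "rot t $ 1 $ 1 = cos t" "rot t $ 1 $ 2 = - sin t"
  "rot t $ 2 $ 1 = sin t" "rot t $ 2 $ 2 = cos t"
  by (simp_all add: rot_def)

lemma mat2_vec_nth: "((M::real^2^2) *v x) $ i = M$i$1 * x$1 + M$i$2 * x$2"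
  by (simp add: matrix_vector_mult_def sum_2)

lemma norm2_sq: "(norm (x::real^2))\<^sup>2 = (x$1)\<^sup>2 + (x$2)\<^sup>2"
  by (simp add: norm_vec_def L2_set_def sum_2)

lemma norm_circ [simp]: "norm (circ t) = 1"
  by (simp add: norm_vec_def L2_set_def sum_2)

lemma circ_nonzero [simp]: "circ t \<noteq> 0"
  using norm_circ[of t] by (metis norm_zero zero_neq_one)

lemma rot_circ: "rot s *v circ t = circ (t + s)"
  by (simp add: vec_eq_iff forall_2 mat2_vec_nth cos_add sin_add algebra_simps)

lemma det_rot [simp]: "det (rot t) = 1"
  using sin_cos_squared_add2[of t] by (simp add: det_2 power2_eq_square)

lemma wed_circ: "wed (circ s) (circ t) = sin (t - s)"
  by (simp add: wed_def sin_diff algebra_simps)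

lemma wed_scaleR [simp]: "wed (a *\<^sub>R x) y = a * wed x y" "wed x (a *\<^sub>R y) = a * wed x y"
  by (simp_all add: wed_def algebra_simps)

lemma wed_matrix: "wed (M *v x) (M *v y) = det M * wed x y"
  by (simp add: wed_def mat2_vec_nth det_2 algebra_simps)

lemma wed_lagrange: "(wed x y)\<^sup>2 + (x \<bullet> y)\<^sup>2 = (norm x)\<^sup>2 * (norm y)\<^sup>2"
  unfolding norm2_sq wed_def inner_vec_def sum_2 by (simp add: power2_eq_square algebra_simps)

lemma wed_self [simp]: "wed x x = 0"
  by (simp add: wed_def)

lemma wed_le: "\<bar>wed x y\<bar> \<le> norm x * norm y"
proof -
  have "(wed x y)\<^sup>2 \<le> (norm x * norm y)\<^sup>2"
    using wed_lagrange[of x y] by (simp add: power_mult_distrib) (smt (verit) zero_le_power2)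
  then show ?thesis by (metis abs_le_square_iff abs_of_nonneg mult_nonneg_nonneg norm_ge_zero)
qed

lemma wed_eq_0_imp:
  assumes "wed x y = 0" "x \<noteq> 0" obtains c where "y = c *\<^sub>R x"
proof -
  have "x$1 \<noteq> 0 \<or> x$2 \<noteq> 0" using assms(2) by (simp add: vec_eq_iff forall_2)
  then have "y = (if x$1 \<noteq> 0 then y$1 / x$1 else y$2 / x$2) *\<^sub>R x"
    using assms(1) by (auto simp: vec_eq_iff forall_2 wed_def field_simps)
  with that show ?thesis by blast
qed

lemma polar_exists:
  obtains t where "x = norm x *\<^sub>R circ t"
proof -
  define z where "z = Complex (x$1) (x$2)"
  have n: "norm z = norm x" by (simp add: z_def cmod_def norm_vec_def L2_set_def sum_2)
  have "z = rcis (norm x) (Arg z)" using n rcis_cmod_Arg[of z] by simp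
  then have "Re z = norm x * cos (Arg z)" "Im z = norm x * sin (Arg z)"
    by (metis Re_rcis, metis Im_rcis)
  then have "x = norm x *\<^sub>R circ (Arg z)" by (simp add: vec_eq_iff forall_2 z_def)
  with that show ?thesis by blast
qed

lemma matrix_2_eqI:
  assumes "\<And>x. (M::real^2^2) *v x = N *v x" shows "M = N"
  using assms by (simp add: matrix_eq)

lemma mat_nonzero_obtain:
  assumes "(M::real^2^2) \<noteq> 0" obtains x where "M *v x \<noteq> 0"
  using assms matrix_2_eqI[of M 0] by (metis matrix_vector_mult_0)

lemma singular_kernel:
  assumes "det (M::real^2^2) = 0" obtains z where "z \<noteq> 0" "M *v z = 0"
  using assms by (meson det_eq_0_rank full_rank_injective invertible_det_nz matrix_left_invertible_ker invertible_left_inverse)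

lemma singular_range:
  assumes "det (M::real^2^2) = 0" shows "wed (M *v x) (M *v y) = 0"
  using assms by (simp add: wed_matrix)

text \<open>Lifts to \<open>\<real>\<close> of the projective action turn monotonicity in the rotation angle into an order relation.\<close>
definition is_lift :: "real^2^2 \<Rightarrow> (real \<Rightarrow> real) \<Rightarrow> bool" where
  "is_lift M f \<longleftrightarrow> continuous_on UNIV f \<and> mono f \<and> (\<forall>t. \<exists>r>0. M *v circ t = r *\<^sub>R circ (f t))"

lemma invertible_mult_nonzero:
  assumes "det (M::real^2^2) \<noteq> 0" "x \<noteq> 0" shows "M *v x \<noteq> 0"
proof
  assume "M *v x = 0"
  moreover obtain N where "N ** M = mat 1" using assms(1) by (auto simp: invertible_det_nz[symmetric] invertible_def)
  ultimately have "x = 0" by (metis matrix_vector_mul_assoc matrix_vector_mul_lid matrix_vector_mult_0_right)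
  with assms show False by simp
qed

text \<open>Since \<open>M *v circ t\<close> never vanishes, it has a continuous logarithm, whose
  imaginary part is the lift. Positivity of \<open>det M\<close> gives
  \<open>sin (f t - f s)\<close> the sign of \<open>sin (t - s)\<close>, and this forces the lift to
  increase.\<close>

lemma lift_exists:
  assumes "det M > 0" shows "\<exists>f. is_lift M f"
proof -
  define g where "g t = Complex ((M *v circ t)$1) ((M *v circ t)$2)" for t
  have g0: "g t \<noteq> 0" for t
    using invertible_mult_nonzero[of M "circ t"] assms circ_nonzero[of t]
    by (auto simp: g_def complex_eq_iff vec_eq_iff[of "M *v circ t"] forall_2 simp del: circ_nonzero)
  have gc: "continuous_on UNIV g"
    unfolding g_def mat2_vec_nth circ_nth by (intro continuous_on_Complex continuous_intros)
  obtain h where h: "continuous_on UNIV h" "\<And>t. g t = exp (h t)"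
    using continuous_logarithm_on_contractible[OF gc] g0
    by (metis UNIV_I contractible_UNIV)
  define f where "f t = Im (h t)" for t
  define r where "r t = exp (Re (h t))" for t
  have r: "r t > 0" for t by (simp add: r_def)
  have "Re (g t) = r t * cos (f t)" "Im (g t) = r t * sin (f t)" for t
    unfolding h(2) f_def r_def by (simp_all add: Re_exp Im_exp)
  then have M: "M *v circ t = r t *\<^sub>R circ (f t)" for t
    by (simp add: g_def vec_eq_iff forall_2)
  have fc: "continuous_on UNIV f" unfolding f_def by (intro continuous_intros h(1))
  have s: "r t * r s * sin (f t - f s) = det M * sin (t - s)" for s t
    using wed_matrix[of M "circ s" "circ t"] by (simp add: M wed_circ mult_ac)
  have loc: "f s < f t" if st: "s < t" "t < s + pi" for s t
  proof (rule ccontr)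
    assume n: "\<not> f s < f t"
    have sp: "sin (f u - f s) > 0" if "s < u" "u \<le> t" for u
    proof -
      have "sin (u - s) > 0" using that st by (intro sin_gt_zero) auto
      then have "r u * r s * sin (f u - f s) > 0" using s[of u s] assms by simp
      then show ?thesis using r[of u] r[of s] by (metis mult_pos_pos zero_less_mult_pos)
    qed
    \<comment> \<open>If \<open>f\<close> did not increase, the sign of the sine would force a drop
      of more than pi. By continuity the drop equals pi somewhere on the way, where the sine is 0
      although \<open>sp\<close> makes it positive.\<close>
    have "sin (f s - f t) < 0" using sp[of t] st by (simp add: sin_diff mult.commute)
    then have "f s - f t > pi"
      using n sin_ge_zero[of "f s - f t"] by (smt (verit) st(1))
    moreover have "continuous_on {s..t} (\<lambda>u. f s - f u)"
      by (intro continuous_intros continuous_on_subset[OF fc]) auto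
    ultimately obtain u where u: "s \<le> u" "u \<le> t" "f s - f u = pi"
      using IVT'[of "\<lambda>u. f s - f u" s pi t] st by auto
    have "u \<noteq> s" using u(3) by auto
    then have "sin (f u - f s) > 0" using sp u by auto
    moreover have "sin (f u - f s) = - sin (f s - f u)" by (metis minus_diff_eq sin_minus)
    ultimately show False using u(3) by simp
  qed
  \<comment> \<open>A longer interval is cut into equal pieces shorter than pi, to which
    \<open>loc\<close> applies.\<close>
  have chain: "f s \<le> f (s + real n * x)" if "0 \<le> x" "x < pi" for s n x
  proof (induction n)
    case (Suc n)
    have "f (s + real n * x) \<le> f (s + real (Suc n) * x)"
      using loc[of "s + real n * x" "s + real (Suc n) * x"] that
      by (cases "x = 0") (auto simp: algebra_simps)
    with Suc show ?case by simp
  qed simp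
  have "f s \<le> f t" if "s \<le> t" for s t
  proof -
    obtain n :: nat where n: "t - s < real n * pi"
      using reals_Archimedean3[OF pi_gt_zero] by blast
    then have n0: "n > 0" using that by (cases n) auto
    have "f s \<le> f (s + real n * ((t - s) / real n))"
      using n n0 that by (intro chain) (auto simp: field_simps)
    then show ?thesis using n0 by simp
  qed
  then have "is_lift M f" unfolding is_lift_def
    using fc M r by (metis monoI)
  then show ?thesis by blast
qed

section \<open>Cotangent estimates for arcs\<close>

lemma cot_sum:
  fixes a x b :: real
  assumes "sin (x - a) \<noteq> 0" "sin (b - x) \<noteq> 0"
  shows "cot (x - a) + cot (b - x) = sin (b - a) / (sin (x - a) * sin (b - x))"
proof -
  have "sin (b - a) = sin ((x - a) + (b - x))" by simp
  also have "\<dots> = sin (x - a) * cos (b - x) + cos (x - a) * sin (b - x)" by (rule sin_add)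
  finally show ?thesis using assms by (simp add: cot_def field_simps)
qed

text \<open>The difference of the cotangents is \<open>sin d / (sin t * sin (t + d))\<close>, whose
  denominator is at most 1. This is the definite gain from lengthening a half-arc by
  \<open>d\<close>.\<close>

lemma cot_diff_ge:
  fixes t d :: real
  assumes "0 < t" "0 < d" "t + d < pi"
  shows "cot (t + d) + sin d \<le> cot t"
proof -
  have p: "sin t > 0" "sin (t + d) > 0" "sin d > 0" using assms by (auto intro!: sin_gt_zero)
  have "sin d = sin (t + d) * cos t - cos (t + d) * sin t"
    using sin_diff[of "t + d" t] by simp
  then have "cot t - cot (t + d) = sin d / (sin t * sin (t + d))"
    using p by (simp add: cot_def field_simps)
  moreover have "sin d * (sin t * sin (t + d)) \<le> sin d * 1"
    using p by (intro mult_left_mono) (auto intro: mult_le_one)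
  ultimately have "cot t - cot (t + d) \<ge> sin d"
    using p by (simp add: pos_le_divide_eq)
  then show ?thesis by simp
qed

lemma cot_mono:
  fixes s t :: real
  assumes "0 < s" "s \<le> t" "t < pi"
  shows "cot t \<le> cot s"
proof (cases "s = t")
  case False
  have "sin (t - s) > 0" using assms False by (intro sin_gt_zero) auto
  then show ?thesis using cot_diff_ge[of s "t - s"] assms False by auto
qed simp

text \<open>For an arc \<open>(a, b)\<close> of length less than \<open>\<pi>\<close>, the function \<open>x \<mapsto> cot (x - a) + cot (b - x)\<close> is the
  density of its Hilbert metric, hence the factor \<open>\<xi>\<^sup>2 / det M\<close>, the inverse of the projective derivative.\<close>
lemma cot_transport:
  assumes M: "M *v circ a = \<alpha> *\<^sub>R circ a'" "M *v circ x = \<xi> *\<^sub>R circ x'" "M *v circ b = \<beta> *\<^sub>R circ b'"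
    and pos: "\<alpha> > 0" "\<xi> > 0" "\<beta> > 0" "det M > 0"
    and s: "sin (x - a) > 0" "sin (b - x) > 0"
  shows "sin (x' - a') > 0" "sin (b' - x') > 0"
    "\<xi>\<^sup>2 * (cot (x - a) + cot (b - x)) = det M * (cot (x' - a') + cot (b' - x'))"
proof -
  \<comment> \<open>\<open>wed_matrix\<close> for three pairs of vectors. In the quotient given by
    \<open>cot_sum\<close> the factors \<open>\<alpha>\<close> and \<open>\<beta>\<close> cancel,
    and only \<open>\<xi>\<^sup>2\<close> and \<open>det M\<close> survive.\<close>
  have e: "\<alpha> * \<xi> * sin (x' - a') = det M * sin (x - a)"
     "\<xi> * \<beta> * sin (b' - x') = det M * sin (b - x)"
     "\<alpha> * \<beta> * sin (b' - a') = det M * sin (b - a)"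
    using wed_matrix[of M "circ a" "circ x"] wed_matrix[of M "circ x" "circ b"]
      wed_matrix[of M "circ a" "circ b"] by (simp_all add: M wed_circ mult_ac)
  have "\<alpha> * \<xi> * sin (x' - a') > 0" "\<xi> * \<beta> * sin (b' - x') > 0"
    unfolding e using pos s by auto
  then show p: "sin (x' - a') > 0" "sin (b' - x') > 0"
    using pos by (metis mult_pos_pos zero_less_mult_pos)+
  have q: "sin (x - a) = \<alpha> * \<xi> * sin (x' - a') / det M" "sin (b - x) = \<xi> * \<beta> * sin (b' - x') / det M"
     "sin (b - a) = \<alpha> * \<beta> * sin (b' - a') / det M" using e pos by (simp_all add: field_simps)
  have "cot (x - a) + cot (b - x) = sin (b - a) / (sin (x - a) * sin (b - x))"
    using s by (intro cot_sum) auto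
  also have "\<dots> = det M * (sin (b' - a') / (sin (x' - a') * sin (b' - x'))) / \<xi>\<^sup>2"
    unfolding q using p pos by (simp add: field_simps power2_eq_square)
  also have "sin (b' - a') / (sin (x' - a') * sin (b' - x')) = cot (x' - a') + cot (b' - x')"
    using p by (intro cot_sum[symmetric]) auto
  finally show "\<xi>\<^sup>2 * (cot (x - a) + cot (b - x)) = det M * (cot (x' - a') + cot (b' - x'))"
    using pos by simp
qed

text \<open>The premise keeps the lines of angles \<open>y\<close> and \<open>z\<close> more than
  \<open>d\<close> apart. Subtracting the nearest multiple of pi moves \<open>y - z\<close> into
  [-pi/2, pi/2], where the sine is monotone.\<close>

lemma abs_sin_ge:
  fixes y z d :: real
  assumes "0 < d" "d < pi/2" and "\<And>j::int. z + of_int j * pi \<notin> {y - d..y + d}"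
  shows "\<bar>sin (y - z)\<bar> \<ge> sin d"
proof -
  define j where "j = round ((y - z) / pi)"
  define u where "u = y - z - of_int j * pi"
  have "\<bar>of_int j - (y - z) / pi\<bar> \<le> 1/2" unfolding j_def by (rule of_int_round_abs_le)
  then have "\<bar>of_int j - (y - z) / pi\<bar> * pi \<le> 1/2 * pi" by (intro mult_right_mono) auto
  moreover have "\<bar>of_int j - (y - z) / pi\<bar> * pi = \<bar>(of_int j - (y - z) / pi) * pi\<bar>" by (simp add: abs_mult)
  moreover have "(of_int j - (y - z) / pi) * pi = - u" by (simp add: u_def field_simps)
  ultimately have u: "\<bar>u\<bar> \<le> pi/2" by simp
  have u2: "\<bar>u\<bar> > d" using assms(3)[of j] by (auto simp: u_def)
  have "sin d \<le> sin \<bar>u\<bar>" using u u2 assms by (intro sin_monotone_2pi_le) auto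
  also have "\<dots> = \<bar>sin u\<bar>" using u sin_ge_zero[of "\<bar>u\<bar>"] by (auto simp: abs_if)
  also have "\<bar>sin u\<bar> = \<bar>sin (y - z)\<bar>" 
  proof -
    have "\<bar>sin (of_int j * pi + u)\<bar> = \<bar>sin u\<bar>"
      using sin_zero_iff_int2[of "of_int j * pi"] sin_cos_squared_add[of "of_int j * pi"]
      by (auto simp: sin_add abs_mult power2_eq_1_iff)
    then show ?thesis by (simp add: u_def)
  qed
  finally show ?thesis .
qed

section \<open>Ranges and kernels of singular matrices\<close>

lemma singular_direction:
  assumes "det (M::real^2^2) = 0" obtains r where "\<And>x. \<exists>c. M *v x = c *\<^sub>R circ r"
proof (cases "\<exists>x0. M *v x0 \<noteq> 0")
  case True
  then obtain x0 where x0: "M *v x0 \<noteq> 0" by blast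
  obtain r where r: "M *v x0 = norm (M *v x0) *\<^sub>R circ r" by (rule polar_exists)
  have "\<exists>c. M *v x = c *\<^sub>R circ r" for x
  proof -
    obtain c where "M *v x = c *\<^sub>R (M *v x0)"
      by (rule wed_eq_0_imp[OF singular_range[OF assms] x0])
    then show ?thesis by (subst (asm) r) auto
  qed
  with that show ?thesis by blast
next
  case False
  \<comment> \<open>The zero matrix has no direction of its own, so any angle serves.\<close>
  then show ?thesis using that[of 0] by (metis scaleR_zero_left)
qed

text \<open>The range of \<open>M\<close> is at most a line. If \<open>N\<close> killed one nonzero
  vector of it, \<open>N\<close> would kill the whole range and the product would vanish.\<close>

lemma singular_then_injective:
  assumes "det (M::real^2^2) = 0" "(N::real^2^2) ** M \<noteq> 0" "N *v (M *v y) = 0" shows "M *v y = 0"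
proof (rule ccontr)
  assume y: "M *v y \<noteq> 0"
  have "(N ** M) *v x = (0::real^2^2) *v x" for x
  proof -
    obtain c where "M *v x = c *\<^sub>R (M *v y)"
      by (rule wed_eq_0_imp[OF singular_range[OF assms(1)] y])
    then show ?thesis
      using assms(3) by (simp add: matrix_vector_mul_assoc[symmetric] matrix_vector_mult_scaleR)
  qed
  then show False using assms(2) matrix_2_eqI by blast
qed

lemma kernel_parallel:
  assumes "(M::real^2^2) \<noteq> 0" "M *v x = 0" "M *v y = 0" shows "wed x y = 0"
proof (rule ccontr)
  assume w: "wed x y \<noteq> 0"
  have e: "M$i$1 * x$1 + M$i$2 * x$2 = 0" "M$i$1 * y$1 + M$i$2 * y$2 = 0" for i
    using assms(2,3) by (metis mat2_vec_nth zero_index)+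
  \<comment> \<open>Cramer's rule: two independent kernel vectors determine each row of
    \<open>M\<close>, which must then be 0.\<close>
  have "M$i$1 * wed x y = (M$i$1 * x$1 + M$i$2 * x$2) * y$2 - (M$i$1 * y$1 + M$i$2 * y$2) * x$2"
    "M$i$2 * wed x y = (M$i$1 * y$1 + M$i$2 * y$2) * x$1 - (M$i$1 * x$1 + M$i$2 * x$2) * y$1" for i
    by (simp_all add: wed_def algebra_simps)
  then have "M$i$1 * wed x y = 0" "M$i$2 * wed x y = 0" for i by (simp_all only: e)
  then have "M$i$1 = 0" "M$i$2 = 0" for i using w by simp_all
  then have "M = 0" by (simp add: vec_eq_iff forall_2)
  with assms show False by simp
qed

section \<open>Products along words and their lifts to angles\<close>

primrec wprod :: "(nat \<Rightarrow> real^2^2) \<Rightarrow> nat list \<Rightarrow> real^2^2" where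
  "wprod A [] = mat 1"
| "wprod A (i # w) = wprod A w ** A i"

lemma wprod_append: "wprod A (u @ v) = wprod A v ** wprod A u"
  by (induction u) (auto simp: matrix_mul_assoc)

lemma det_wprod: "det (wprod A w) = (\<Prod>i\<leftarrow>w. det (A i))"
  by (induction w) (auto simp: det_mul)

lemma det_wprod_nonneg: "(\<And>i. i \<in> set w \<Longrightarrow> det (A i) \<ge> 0) \<Longrightarrow> det (wprod A w) \<ge> 0"
  unfolding det_wprod by (induction w) auto

lemma det_wprod_pos: "(\<And>i. i \<in> set w \<Longrightarrow> det (A i) > 0) \<Longrightarrow> det (wprod A w) > 0"
  unfolding det_wprod by (induction w) auto

lemma det_wprod_eq_0: "i \<in> set w \<Longrightarrow> det (A i) = 0 \<Longrightarrow> det (wprod A w) = 0"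
  unfolding det_wprod by (induction w) auto

definition adm :: "nat set \<Rightarrow> (nat \<Rightarrow> nat \<Rightarrow> bool) \<Rightarrow> nat list \<Rightarrow> bool" where
  "adm S E w \<longleftrightarrow> set w \<subseteq> S \<and> successively E w"

lemma adm_append: "adm S E (u @ v) \<longleftrightarrow>
    adm S E u \<and> adm S E v \<and> (u = [] \<or> v = [] \<or> E (last u) (hd v))"
  unfolding adm_def by (auto simp: successively_append_iff)

lemma adm_Nil [simp]: "adm S E []" by (simp add: adm_def)

lemma adm_singleton [simp]: "adm S E [i] \<longleftrightarrow> i \<in> S" by (simp add: adm_def)

lemma adm_Cons: "adm S E (i # w) \<longleftrightarrow> i \<in> S \<and> adm S E w \<and> (w = [] \<or> E i (hd w))"
  using adm_append[of S E "[i]" w] by auto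

text \<open>The lift to angles of the product of the rotated letters
  \<open>rot \<theta> ** A i\<close>; see \<open>lift_word_circ\<close>.\<close>

primrec lift_word :: "(nat \<Rightarrow> real \<Rightarrow> real) \<Rightarrow> real \<Rightarrow> nat list \<Rightarrow> real \<Rightarrow> real" where
  "lift_word f \<theta> [] t = t"
| "lift_word f \<theta> (i # w) t = lift_word f \<theta> w (f i t + \<theta>)"

lemma lift_word_append: "lift_word f \<theta> (u @ v) t = lift_word f \<theta> v (lift_word f \<theta> u t)"
  by (induction u arbitrary: t) auto

lemma lift_word_mono:
  assumes "\<And>i. i \<in> set w \<Longrightarrow> mono (f i)" "\<theta> \<le> \<theta>'" "t \<le> t'"
  shows "lift_word f \<theta> w t \<le> lift_word f \<theta>' w t'"
  using assms
proof (induction w arbitrary: t t')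
  case (Cons i w)
  have "f i t + \<theta> \<le> f i t' + \<theta>'" using Cons.prems by (intro add_mono) (auto dest: monoD)
  with Cons show ?case by auto
qed simp

lemma lift_word_continuous:
  assumes "\<And>i. i \<in> set w \<Longrightarrow> continuous_on UNIV (f i)" "continuous_on T g"
  shows "continuous_on T (\<lambda>\<theta>. lift_word f \<theta> w (g \<theta>))"
  using assms
proof (induction w arbitrary: g)
  case (Cons i w)
  have "continuous_on T (\<lambda>\<theta>. f i (g \<theta>))"
    by (rule continuous_on_compose2[of UNIV]) (use Cons.prems in auto)
  then have "continuous_on T (\<lambda>\<theta>. f i (g \<theta>) + \<theta>)" by (intro continuous_intros)
  then show ?case using Cons by simp
qed simp

lemma lift_word_circ:
  assumes "\<And>i. i \<in> set w \<Longrightarrow> is_lift (A i) (f i)"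
  shows "\<exists>r>0. wprod (\<lambda>i. rot \<theta> ** A i) w *v circ t = r *\<^sub>R circ (lift_word f \<theta> w t)"
  using assms
proof (induction w arbitrary: t)
  case Nil
  show ?case by (auto intro: exI[of _ 1])
next
  case (Cons i w)
  obtain a where a: "a > 0" "A i *v circ t = a *\<^sub>R circ (f i t)"
    using Cons.prems[of i] by (auto simp: is_lift_def)
  obtain b where b: "b > 0" "wprod (\<lambda>i. rot \<theta> ** A i) w *v circ (f i t + \<theta>) = b *\<^sub>R circ (lift_word f \<theta> w (f i t + \<theta>))"
    using Cons.IH[of "f i t + \<theta>"] Cons.prems by auto
  have "wprod (\<lambda>i. rot \<theta> ** A i) (i # w) *v circ t = (a * b) *\<^sub>R circ (lift_word f \<theta> (i # w) t)"
    using a b by (simp add: matrix_vector_mul_assoc[symmetric] matrix_vector_mult_scaleR rot_circ)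
  with a(1) b(1) show ?case by (metis mult_pos_pos)
qed

lemma rot_0 [simp]: "rot 0 = mat 1"
  by (simp add: vec_eq_iff forall_2 mat_def)

lemma lift_word_circ0:
  assumes "\<And>i. i \<in> set w \<Longrightarrow> is_lift (A i) (f i)"
  shows "\<exists>r>0. wprod A w *v circ t = r *\<^sub>R circ (lift_word f 0 w t)"
  using lift_word_circ[of w A f 0 t] assms by simp

text \<open>The initial angle is \<open>r + \<theta>\<close> because the singular letter with range \<open>r\<close> is rotated as well.\<close>
definition orbit_angle :: "(nat \<Rightarrow> real \<Rightarrow> real) \<Rightarrow> real \<Rightarrow> nat list \<Rightarrow> real \<Rightarrow> real" where
  "orbit_angle f r u \<theta> = lift_word f \<theta> u (r + \<theta>)"

lemma orbit_angle_snoc: "orbit_angle f r (u @ [i]) \<theta> = f i (orbit_angle f r u \<theta>) + \<theta>"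
  by (simp add: orbit_angle_def lift_word_append)

text \<open>The last rotation alone contributes \<open>\<theta>' - \<theta>\<close>, and by
  monotonicity of the lifts all earlier ones turn the same way. For the empty word the initial angle
  \<open>r + \<theta>\<close> supplies the gap.\<close>

lemma orbit_angle_gap:
  assumes "\<And>i. i \<in> set u \<Longrightarrow> mono (f i)" "\<theta> \<le> \<theta>'"
  shows "orbit_angle f r u \<theta> + (\<theta>' - \<theta>) \<le> orbit_angle f r u \<theta>'"
proof (cases u rule: rev_cases)
  case (snoc v i)
  have "orbit_angle f r v \<theta> \<le> orbit_angle f r v \<theta>'"
    unfolding orbit_angle_def using assms snoc by (intro lift_word_mono) auto
  then have "f i (orbit_angle f r v \<theta>) \<le> f i (orbit_angle f r v \<theta>')"
    using assms(1)[of i] snoc by (auto dest: monoD)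
  then show ?thesis by (simp add: snoc orbit_angle_snoc)
qed (simp add: orbit_angle_def)

section \<open>Expansion of past directions\<close>

text \<open>\<open>nonnull\<close> says that the approximation by cocycles with a null word fails at
  scale \<open>\<epsilon>\<close>. The goal of the locale is
  \<open>uniformly_hyperbolic\<close>.\<close>

locale robustly_nonnull =
  fixes S :: "nat set" and E :: "nat \<Rightarrow> nat \<Rightarrow> bool" and A :: "nat \<Rightarrow> real^2^2" and \<epsilon> :: real
  assumes det_nonneg: "i \<in> S \<Longrightarrow> det (A i) \<ge> 0"
    and eps: "0 < \<epsilon>" "\<epsilon> < pi / 2"
    and nonnull: "\<bar>\<theta>\<bar> \<le> \<epsilon> \<Longrightarrow> adm S E w \<Longrightarrow> wprod (\<lambda>i. rot \<theta> ** A i) w \<noteq> 0"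
    and connected: "i \<in> S \<Longrightarrow> j \<in> S \<Longrightarrow> \<exists>w. adm S E (i # w @ [j])"
    and singular_letter: "\<exists>s\<in>S. det (A s) = 0"
begin

definition lift :: "nat \<Rightarrow> real \<Rightarrow> real" where
  "lift i = (SOME f. is_lift (A i) f)"

lemma is_lift: "i \<in> S \<Longrightarrow> det (A i) \<noteq> 0 \<Longrightarrow> is_lift (A i) (lift i)"
  unfolding lift_def using lift_exists[of "A i"] det_nonneg[of i] by (metis less_le someI_ex)

abbreviation inv_word :: "nat list \<Rightarrow> bool" where
  "inv_word u \<equiv> (\<forall>i\<in>set u. i \<in> S \<and> det (A i) \<noteq> 0)"

lemma lift_mono: "i \<in> S \<Longrightarrow> det (A i) \<noteq> 0 \<Longrightarrow> mono (lift i)"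
  using is_lift by (auto simp: is_lift_def)

lemma lift_cont: "i \<in> S \<Longrightarrow> det (A i) \<noteq> 0 \<Longrightarrow> continuous_on UNIV (lift i)"
  using is_lift by (auto simp: is_lift_def)

lemma wprod_nonzero: "adm S E w \<Longrightarrow> wprod A w \<noteq> 0"
  using nonnull[of 0 w] eps by simp

text \<open>Otherwise the rotated word is null: \<open>s\<close> maps every vector into direction
  \<open>r\<close>, the rotated word \<open>u\<close> carries this direction to the orbit angle, and
  \<open>s'\<close> kills it.\<close>

lemma orbit_not_in_kernel:
  assumes ad: "adm S E (s # u @ [s'])" and u: "inv_word u"
    and r: "\<And>x. \<exists>c. A s *v x = c *\<^sub>R circ r" and th: "\<bar>\<theta>\<bar> \<le> \<epsilon>"
  shows "A s' *v circ (orbit_angle lift r u \<theta>) \<noteq> 0"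
proof
  assume 0: "A s' *v circ (orbit_angle lift r u \<theta>) = 0"
  have "wprod (\<lambda>i. rot \<theta> ** A i) (s # u @ [s']) *v x = (0::real^2^2) *v x" for x
  proof -
    obtain c where c: "A s *v x = c *\<^sub>R circ r" using r by blast
    obtain a where a: "wprod (\<lambda>i. rot \<theta> ** A i) u *v circ (r + \<theta>) = a *\<^sub>R circ (lift_word lift \<theta> u (r + \<theta>))"
      using lift_word_circ[of u A lift \<theta> "r + \<theta>"] u is_lift by auto
    show ?thesis
      using 0 by (simp add: wprod_append matrix_vector_mul_assoc[symmetric] c a rot_circ
          matrix_vector_mult_scaleR orbit_angle_def)
  qed
  then show False using nonnull[OF th ad] matrix_2_eqI by blast
qed

text \<open>An angle \<open>z\<close> in the swept arc would be carried by \<open>v\<close> to a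
  kernel angle of \<open>s'\<close> lying between the two extreme orbit angles of
  \<open>u @ v\<close>. By the intermediate value theorem some rotation would hit it, against
  \<open>orbit_not_in_kernel\<close>.\<close>

lemma kernel_angle_avoided:
  assumes ad: "adm S E (s # u @ v @ [s'])" and u: "inv_word u" and v: "inv_word v"
    and r: "\<And>x. \<exists>c. A s *v x = c *\<^sub>R circ r"
    and z: "A s' *v (wprod A v *v circ z) = 0"
  shows "z \<notin> {orbit_angle lift r u (-\<epsilon>)..orbit_angle lift r u \<epsilon>}"
proof
  assume zin: "z \<in> {orbit_angle lift r u (-\<epsilon>)..orbit_angle lift r u \<epsilon>}"
  define Y where "Y = orbit_angle lift r (u @ v)"
  have Y: "Y \<theta> = lift_word lift \<theta> v (orbit_angle lift r u \<theta>)" for \<theta>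
    by (simp add: Y_def orbit_angle_def lift_word_append)
  define \<kappa> where "\<kappa> = lift_word lift 0 v z"
  obtain a where a: "a > 0" "wprod A v *v circ z = a *\<^sub>R circ \<kappa>"
    using lift_word_circ0[of v A lift z] v is_lift unfolding \<kappa>_def by auto
  have \<kappa>0: "A s' *v circ \<kappa> = 0" using z a by (simp add: matrix_vector_mult_scaleR)
  have Yk: "Y \<theta> \<noteq> \<kappa>" if "\<bar>\<theta>\<bar> \<le> \<epsilon>" for \<theta>
    using orbit_not_in_kernel[of s "u @ v" s' r \<theta>] ad u v r that \<kappa>0 unfolding Y_def by auto
  have Yc: "continuous_on T Y" for T
    unfolding Y_def orbit_angle_def using u v lift_cont
    by (intro lift_word_continuous continuous_intros) auto
  have m: "lift_word lift \<theta> v t \<le> lift_word lift \<theta>' v t'" if "\<theta> \<le> \<theta>'" "t \<le> t'" for \<theta> \<theta>' t t'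
    using v lift_mono that by (intro lift_word_mono) auto
  \<comment> \<open>\<open>\<kappa>\<close> uses the unrotated word \<open>v\<close>, the case
    \<open>\<theta> = 0\<close>, so joint monotonicity in the rotation and the initial angle puts it
    between the extremes.\<close>
  have "\<kappa> \<le> Y \<epsilon>" "Y (-\<epsilon>) \<le> \<kappa>" unfolding Y \<kappa>_def using zin eps by (auto intro!: m)
  then obtain \<theta> where "-\<epsilon> \<le> \<theta>" "\<theta> \<le> \<epsilon>" "Y \<theta> = \<kappa>"
    using IVT'[of Y "-\<epsilon>" \<kappa> \<epsilon>] Yc eps by auto
  then show False using Yk[of \<theta>] by auto
qed

text \<open>Connect the last letter to a singular one and stop at the first singular letter on the
  way.\<close>

lemma extend_to_singular:
  assumes "adm S E (s # u)"
  obtains v s' where "adm S E (s # u @ v @ [s'])" "inv_word v" "det (A s') = 0" "s' \<in> S"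
proof -
  obtain s0 where s0: "s0 \<in> S" "det (A s0) = 0" using singular_letter by blast
  define l where "l = last (s # u)"
  have "l \<in> S" unfolding l_def using assms last_in_set[of "s # u"] unfolding adm_def by blast
  then obtain w where w: "adm S E (l # w @ [s0])" using connected s0 by blast
  have "\<exists>s'\<in>set (w @ [s0]). det (A s') = 0" using s0 by auto
  then obtain v s' v' where v: "w @ [s0] = v @ s' # v'" "det (A s') = 0" "\<forall>i\<in>set v. det (A i) \<noteq> 0"
    using split_list_first_prop[of "w @ [s0]" "\<lambda>i. det (A i) = 0"] by blast
  have "adm S E ((s # u) @ (w @ [s0]))"
    using assms w by (subst adm_append) (auto simp: adm_Cons l_def)
  then have "adm S E ((s # u @ v @ [s']) @ v')" unfolding v by simp
  then have ad: "adm S E (s # u @ v @ [s'])" by (subst (asm) adm_append) simp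
  show ?thesis by (rule that[OF ad _ v(2)]) (use v ad in \<open>auto simp: adm_def\<close>)
qed

text \<open>Some continuation of the word is singular, and its kernel line has an angle in every
  closed interval of length pi. The arc avoids all these angles, so it is shorter.\<close>

lemma orbit_angle_range:
  assumes ad: "adm S E (s # u)" and u: "inv_word u" and r: "\<And>x. \<exists>c. A s *v x = c *\<^sub>R circ r"
  shows "orbit_angle lift r u \<epsilon> - orbit_angle lift r u (-\<epsilon>) < pi"
proof (rule ccontr)
  assume n: "\<not> ?thesis"
  obtain v s' where v: "adm S E (s # u @ v @ [s'])" "inv_word v" "det (A s') = 0"
    using extend_to_singular[OF ad] by metis
  have "det (A s' ** wprod A v) = 0" using v by (simp add: det_mul)
  then obtain z0 where z0: "z0 \<noteq> 0" "(A s' ** wprod A v) *v z0 = 0" using singular_kernel by blast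
  obtain z where z: "z0 = norm z0 *\<^sub>R circ z" by (rule polar_exists)
  have "norm z0 *\<^sub>R ((A s' ** wprod A v) *v circ z) = 0"
    using z0(2) z by (metis matrix_vector_mult_scaleR)
  then have k: "(A s' ** wprod A v) *v circ z = 0" using z0 by simp
  define a where "a = orbit_angle lift r u (-\<epsilon>)"
  \<comment> \<open>The representative of the kernel angle that lies in
    \<open>{a..a + pi}\<close>.\<close>
  define j where "j = \<lceil>(a - z) / pi\<rceil>"
  have "(a - z) / pi \<le> of_int j" "of_int j < (a - z) / pi + 1" unfolding j_def by linarith+
  then have j: "a \<le> z + of_int j * pi" "z + of_int j * pi \<le> a + pi" by (simp_all add: field_simps)
  have "wed (circ z) (circ (z + of_int j * pi)) = 0"
    by (simp add: wed_circ sin_zero_iff_int2)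
  then obtain c where "circ (z + of_int j * pi) = c *\<^sub>R circ z" by (rule wed_eq_0_imp) auto
  then have "(A s' ** wprod A v) *v circ (z + of_int j * pi) = 0"
    using k by (simp add: matrix_vector_mult_scaleR)
  then have "z + of_int j * pi \<notin> {orbit_angle lift r u (-\<epsilon>)..orbit_angle lift r u \<epsilon>}"
    using kernel_angle_avoided[OF v(1) u v(2) r] by (simp add: matrix_vector_mul_assoc)
  then show False using j n by (auto simp: a_def)
qed

text \<open>By \<open>orbit_angle_gap\<close> the swept arc contains the
  \<open>\<epsilon>\<close>-neighbourhood of the unperturbed direction \<open>y 0\<close>. It avoids
  every representative of the kernel angle, so the two lines are at least \<open>\<epsilon>\<close>
  apart.\<close>

lemma transversal_core:
  assumes ad: "adm S E (s # u @ v @ [s'])" and s: "det (A s) = 0" and u: "inv_word u" and v: "inv_word v"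
    and z: "wprod A (v @ [s']) *v z = 0"
  shows "sin \<epsilon> * (norm (wprod A (s # u) *v x0) * norm z) \<le> \<bar>wed (wprod A (s # u) *v x0) z\<bar>"
proof -
  obtain r where r: "\<And>x. \<exists>c. A s *v x = c *\<^sub>R circ r" using singular_direction[OF s] by blast
  define y where "y = orbit_angle lift r u"
  obtain c where c: "A s *v x0 = c *\<^sub>R circ r" using r by blast
  obtain a where a: "a > 0" "wprod A u *v circ r = a *\<^sub>R circ (y 0)"
    using lift_word_circ0[of u A lift r] u is_lift by (auto simp: y_def orbit_angle_def)
  have x: "wprod A (s # u) *v x0 = (c * a) *\<^sub>R circ (y 0)"
    using c a by (simp add: matrix_vector_mul_assoc[symmetric] matrix_vector_mult_scaleR)
  obtain \<zeta> where \<zeta>: "z = norm z *\<^sub>R circ \<zeta>" by (rule polar_exists)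
  have "sin \<epsilon> \<le> \<bar>sin (\<zeta> - y 0)\<bar>" if z0: "z \<noteq> 0"
  proof -
    have "norm z *\<^sub>R (wprod A (v @ [s']) *v circ \<zeta>) = 0"
      using z \<zeta> by (metis matrix_vector_mult_scaleR)
    then have k: "wprod A (v @ [s']) *v circ \<zeta> = 0" using z0 by simp
    have "\<zeta> + of_int j * pi \<notin> {y 0 - \<epsilon>..y 0 + \<epsilon>}" for j :: int
    proof -
      have "wed (circ \<zeta>) (circ (\<zeta> + of_int j * pi)) = 0"
        by (simp add: wed_circ sin_zero_iff_int2)
      then obtain d where "circ (\<zeta> + of_int j * pi) = d *\<^sub>R circ \<zeta>" by (rule wed_eq_0_imp) auto
      then have "wprod A (v @ [s']) *v circ (\<zeta> + of_int j * pi) = 0"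
        using k by (simp add: matrix_vector_mult_scaleR)
      then have "\<zeta> + of_int j * pi \<notin> {y (-\<epsilon>)..y \<epsilon>}"
        unfolding y_def
        by (intro kernel_angle_avoided[OF ad u v r]) (simp add: wprod_append matrix_vector_mul_assoc)
      moreover have "y (-\<epsilon>) + (0 - - \<epsilon>) \<le> y 0" "y 0 + (\<epsilon> - 0) \<le> y \<epsilon>"
        unfolding y_def using u lift_mono eps by (intro orbit_angle_gap; force)+
      ultimately show ?thesis by auto
    qed
    then have "sin \<epsilon> \<le> \<bar>sin (y 0 - \<zeta>)\<bar>" by (intro abs_sin_ge eps)
    then show ?thesis by (metis abs_minus_cancel minus_diff_eq sin_minus)
  qed
  then have "sin \<epsilon> * (\<bar>c * a\<bar> * norm z) \<le> \<bar>sin (\<zeta> - y 0)\<bar> * (\<bar>c * a\<bar> * norm z)"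
    by (cases "z = 0") (auto intro!: mult_right_mono)
  also have "\<dots> = \<bar>wed (wprod A (s # u) *v x0) z\<bar>"
    by (subst \<zeta>, simp only: x wed_scaleR wed_circ) (simp add: abs_mult mult_ac)
  finally have "sin \<epsilon> * (\<bar>c * a\<bar> * norm z) \<le> \<bar>wed (wprod A (s # u) *v x0) z\<bar>" .
  moreover have "norm (wprod A (s # u) *v x0) = \<bar>c * a\<bar>" by (simp only: x) simp
  ultimately show ?thesis by (simp only:)
qed

section \<open>Growth from the Hilbert metrics of the arcs\<close>

definition \<delta> :: real where "\<delta> = \<epsilon> / 2"

text \<open>Only half of the available rotation range is used: the other half keeps the arcs shorter than
  \<open>\<pi> - 2 \<delta>\<close>, which bounds their metric densities from below.\<close>
definition spread :: "real \<Rightarrow> nat list \<Rightarrow> real" where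
  "spread r u = cot (orbit_angle lift r u 0 - orbit_angle lift r u (-\<delta>))
    + cot (orbit_angle lift r u \<delta> - orbit_angle lift r u 0)"

text \<open>Each letter lowers the density by at least \<open>2 * sin \<delta>\<close>, while the
  density left is at most \<open>2 * cot \<delta>\<close>; the quotient of the two is the relative
  gain.\<close>

definition rate :: real where "rate = 1 + sin \<delta> / cot \<delta>"

lemma delta_pos: "0 < \<delta>" "\<delta> < pi / 4" "sin \<delta> > 0" "cos \<delta> > 0" "cot \<delta> > 0" "sin (2 * \<delta>) > 0"
proof -
  show a: "0 < \<delta>" "\<delta> < pi / 4" using eps by (auto simp: \<delta>_def)
  show "sin \<delta> > 0" "sin (2 * \<delta>) > 0" by (rule sin_gt_zero; use a in linarith)+
  moreover show "cos \<delta> > 0" by (rule cos_gt_zero) (use a in linarith)+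
  ultimately show "cot \<delta> > 0" by (simp add: cot_def)
qed

lemma rate_gt_1: "rate > 1"
  using delta_pos by (simp add: rate_def)

context
  fixes s u r
  assumes ad: "adm S E (s # u)" and u: "inv_word u" and r: "\<And>x. \<exists>c. A s *v x = c *\<^sub>R circ r"
begin

lemma arc_bounds:
  shows "\<delta> \<le> orbit_angle lift r u 0 - orbit_angle lift r u (-\<delta>)"
    and "\<delta> \<le> orbit_angle lift r u \<delta> - orbit_angle lift r u 0"
    and "orbit_angle lift r u \<delta> - orbit_angle lift r u (-\<delta>) < pi - 2 * \<delta>"
proof -
  have g: "orbit_angle lift r u \<theta> + (\<theta>' - \<theta>) \<le> orbit_angle lift r u \<theta>'" if "\<theta> \<le> \<theta>'" for \<theta> \<theta>'
    using u lift_mono that by (intro orbit_angle_gap) auto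
  show "\<delta> \<le> orbit_angle lift r u 0 - orbit_angle lift r u (-\<delta>)"
    "\<delta> \<le> orbit_angle lift r u \<delta> - orbit_angle lift r u 0"
    using g[of "-\<delta>" 0] g[of 0 \<delta>] delta_pos by auto
  \<comment> \<open>The rotations between \<open>\<delta>\<close> and \<open>\<epsilon>\<close>, on
    either side, account for at least \<open>\<delta>\<close> each in the full sweep, which is
    shorter than pi.\<close>
  have "orbit_angle lift r u \<delta> + \<delta> \<le> orbit_angle lift r u \<epsilon>"
    "orbit_angle lift r u (-\<epsilon>) + \<delta> \<le> orbit_angle lift r u (-\<delta>)"
    using g[of \<delta> \<epsilon>] g[of "-\<epsilon>" "-\<delta>"] eps by (auto simp: \<delta>_def)
  then show "orbit_angle lift r u \<delta> - orbit_angle lift r u (-\<delta>) < pi - 2 * \<delta>"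
    using orbit_angle_range[OF ad u r] by linarith
qed

lemma arc_sin_pos:
  shows "sin (orbit_angle lift r u 0 - orbit_angle lift r u (-\<delta>)) > 0"
    and "sin (orbit_angle lift r u \<delta> - orbit_angle lift r u 0) > 0"
  by (rule sin_gt_zero; use arc_bounds delta_pos in linarith)+

text \<open>Below: by \<open>cot_sum\<close> the density is the sine of the whole arc, whose length
  lies in [2 \<delta>, pi - 2 \<delta>], over a product of sines at most 1. Above: both half-arcs
  have length at least \<open>\<delta>\<close>.\<close>

lemma spread_bounds: "sin (2 * \<delta>) \<le> spread r u" "spread r u \<le> 2 * cot \<delta>"
proof -
  let ?y = "orbit_angle lift r u"
  have e: "spread r u = sin (?y \<delta> - ?y (-\<delta>)) / (sin (?y 0 - ?y (-\<delta>)) * sin (?y \<delta> - ?y 0))"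
    unfolding spread_def using arc_sin_pos by (intro cot_sum) auto
  define t where "t = ?y \<delta> - ?y (-\<delta>)"
  have t: "2 * \<delta> \<le> t" "t \<le> pi - 2 * \<delta>" using arc_bounds unfolding t_def by linarith+
  have st: "sin (2 * \<delta>) \<le> sin t"
  proof (cases "t \<le> pi / 2")
    case True
    then show ?thesis using t delta_pos by (intro sin_monotone_2pi_le) auto
  next
    case False
    have "sin (2 * \<delta>) \<le> sin (pi - t)" using t False delta_pos by (intro sin_monotone_2pi_le) auto
    then show ?thesis by simp
  qed
  have "sin t * (sin (?y 0 - ?y (-\<delta>)) * sin (?y \<delta> - ?y 0)) \<le> sin t * 1"
    using st delta_pos arc_sin_pos by (intro mult_left_mono mult_le_one) auto
  then have "sin t \<le> spread r u"
    unfolding e t_def using arc_sin_pos by (simp add: pos_le_divide_eq)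
  with st show "sin (2 * \<delta>) \<le> spread r u" by simp
  have "cot (?y 0 - ?y (-\<delta>)) \<le> cot \<delta>" "cot (?y \<delta> - ?y 0) \<le> cot \<delta>"
    using arc_bounds delta_pos by (intro cot_mono; linarith)+
  then show "spread r u \<le> 2 * cot \<delta>" by (simp add: spread_def)
qed

end

text \<open>The matrix itself transports the density exactly, by \<open>cot_transport\<close>. The
  following rotations push both ends outwards by \<open>\<delta>\<close>, which costs at least
  \<open>sin \<delta>\<close> in each cotangent.\<close>

lemma spread_step:
  assumes ad: "adm S E (s # u @ [i])" and u: "inv_word u" and i: "i \<in> S" "det (A i) \<noteq> 0"
    and r: "\<And>x. \<exists>c. A s *v x = c *\<^sub>R circ r"
  shows "rate * spread r (u @ [i]) * det (A i)
    \<le> (norm (A i *v circ (orbit_angle lift r u 0)))\<^sup>2 * spread r u"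
proof -
  let ?y = "orbit_angle lift r u" and ?Y = "orbit_angle lift r (u @ [i])"
  have D: "det (A i) > 0" using det_nonneg[OF i(1)] i(2) by simp
  have ad': "adm S E (s # u)" using ad adm_append[of S E "s # u" "[i]"] by simp
  have u': "inv_word (u @ [i])" using u i by simp
  have L: "is_lift (A i) (lift i)" using i by (rule is_lift)
  then obtain \<rho> where \<rho>: "\<And>t. \<rho> t > 0" "\<And>t. A i *v circ t = \<rho> t *\<^sub>R circ (lift i t)"
    unfolding is_lift_def by metis
  note yb = arc_bounds[OF ad' u r] and Yb = arc_bounds[OF ad u' r]
  define t1 t2 where "t1 = lift i (?y 0) - lift i (?y (-\<delta>))" and "t2 = lift i (?y \<delta>) - lift i (?y 0)"
  \<comment> \<open>The last rotation moves the ends by \<open>-\<delta>\<close> and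
    \<open>\<delta>\<close> and leaves the middle point fixed, so both half-arcs grow by
    \<open>\<delta>\<close>.\<close>
  have T: "?Y 0 - ?Y (-\<delta>) = t1 + \<delta>" "?Y \<delta> - ?Y 0 = t2 + \<delta>"
    by (simp_all add: orbit_angle_snoc t1_def t2_def)
  note tr = cot_transport[OF \<rho>(2)[of "?y (-\<delta>)"] \<rho>(2)[of "?y 0"] \<rho>(2)[of "?y \<delta>"] \<rho>(1) \<rho>(1) \<rho>(1) D
      arc_sin_pos[OF ad' u r]]
  have "t1 \<ge> 0" "t2 \<ge> 0"
    unfolding t1_def t2_def
    using monoD[OF lift_mono[OF i], of "?y (-\<delta>)" "?y 0"] monoD[OF lift_mono[OF i], of "?y 0" "?y \<delta>"]
      yb(1,2) delta_pos(1) by auto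
  moreover have "t1 \<noteq> 0" "t2 \<noteq> 0" using tr(1,2) unfolding t1_def t2_def by auto
  ultimately have tp: "t1 > 0" "t2 > 0" by auto
  have tu: "t1 + \<delta> < pi" "t2 + \<delta> < pi" using Yb T delta_pos(1) by linarith+
  have "cot (t1 + \<delta>) + sin \<delta> \<le> cot t1" "cot (t2 + \<delta>) + sin \<delta> \<le> cot t2"
    using tp tu delta_pos(1) by (intro cot_diff_ge; simp)+
  then have S1: "spread r (u @ [i]) + 2 * sin \<delta> \<le> cot t1 + cot t2"
    unfolding spread_def T by linarith
  have "rate * spread r (u @ [i]) = spread r (u @ [i]) + sin \<delta> / cot \<delta> * spread r (u @ [i])"
    by (simp add: rate_def algebra_simps)
  also have "sin \<delta> / cot \<delta> * spread r (u @ [i]) \<le> sin \<delta> / cot \<delta> * (2 * cot \<delta>)"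
    using spread_bounds(2)[OF ad u' r] delta_pos by (intro mult_left_mono) auto
  also have "\<dots> = 2 * sin \<delta>" using delta_pos by simp
  finally have "rate * spread r (u @ [i]) \<le> cot t1 + cot t2" using S1 by simp
  then have "det (A i) * (rate * spread r (u @ [i])) \<le> det (A i) * (cot t1 + cot t2)"
    using D by (intro mult_left_mono) auto
  also have "\<dots> = (\<rho> (?y 0))\<^sup>2 * spread r u"
    using tr(3) by (simp add: t1_def t2_def spread_def)
  finally show ?thesis using \<rho>(1)[of "?y 0"] by (simp add: \<rho>(2) mult_ac)
qed

text \<open>The lower bound of \<open>spread\<close> divided by its upper bound.\<close>

definition growth_const :: real where "growth_const = sin (2 * \<delta>) / (2 * cot \<delta>)"

lemma growth_const_pos: "growth_const > 0"
  using delta_pos by (simp add: growth_const_def)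

text \<open>Multiplying \<open>spread_step\<close> along \<open>w\<close> accumulates the norm
  growth on one side, and \<open>rate\<close> and the determinants on the other. The densities at
  the two ends are then replaced by the constants of \<open>spread_bounds\<close>.\<close>

lemma growth_core:
  assumes ad: "adm S E (s # u @ w)" and s: "det (A s) = 0" and u: "inv_word u" and w: "inv_word w"
    and x: "x = wprod A (s # u) *v x0"
  shows "growth_const * rate ^ length w * det (wprod A w) * (norm x)\<^sup>2 \<le> (norm (wprod A w *v x))\<^sup>2"
proof -
  obtain r where r: "\<And>x. \<exists>c. A s *v x = c *\<^sub>R circ r" using singular_direction[OF s] by blast
  obtain c where c: "A s *v x0 = c *\<^sub>R circ r" using r by blast
  \<comment> \<open>At rotation 0 the orbit angle is the direction of the actual, unperturbed image
    vector.\<close>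
  have dir: "\<exists>b. wprod A (s # v) *v x0 = b *\<^sub>R circ (orbit_angle lift r v 0)" if v: "inv_word v" for v
  proof -
    obtain a where "wprod A v *v circ r = a *\<^sub>R circ (orbit_angle lift r v 0)"
      using lift_word_circ0[of v A lift r] v is_lift by (auto simp: orbit_angle_def)
    then have "wprod A (s # v) *v x0 = (c * a) *\<^sub>R circ (orbit_angle lift r v 0)"
      using c by (simp add: matrix_vector_mul_assoc[symmetric] matrix_vector_mult_scaleR)
    then show ?thesis by blast
  qed
  have main: "rate ^ length w * spread r (u @ w) * det (wprod A w) * (norm x)\<^sup>2
      \<le> (norm (wprod A w *v x))\<^sup>2 * spread r u"
    using ad w
  proof (induction w rule: rev_induct)
    case Nil
    then show ?case by simp
  next
    case (snoc i w)
    have adw: "adm S E (s # u @ w)" using snoc.prems(1) adm_append[of S E "s # u @ w" "[i]"] by simp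
    have iw: "inv_word w" "i \<in> S" "det (A i) \<noteq> 0" "inv_word (u @ w)" using snoc.prems u by auto
    have D: "det (wprod A w) > 0" "det (A i) > 0"
      using iw det_nonneg by (force intro!: det_wprod_pos simp: less_le)+
    define X where "X = wprod A w *v x"
    have X: "X = wprod A (s # u @ w) *v x0"
      by (simp add: X_def x wprod_append matrix_vector_mul_assoc matrix_mul_assoc)
    obtain b where b: "X = b *\<^sub>R circ (orbit_angle lift r (u @ w) 0)" using dir[OF iw(4)] X by auto
    have st: "rate * spread r (u @ w @ [i]) * det (A i)
      \<le> (norm (A i *v circ (orbit_angle lift r (u @ w) 0)))\<^sup>2 * spread r (u @ w)"
      using spread_step[of s "u @ w" i r] snoc.prems(1) iw r by simp
    have "(rate * spread r (u @ w @ [i]) * det (A i)) * b\<^sup>2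
      \<le> ((norm (A i *v circ (orbit_angle lift r (u @ w) 0)))\<^sup>2 * spread r (u @ w)) * b\<^sup>2"
      using st by (rule mult_right_mono) auto
    also have "\<dots> = (norm (A i *v X))\<^sup>2 * spread r (u @ w)"
      by (simp add: b matrix_vector_mult_scaleR power_mult_distrib mult_ac)
    finally have "(rate * spread r (u @ w @ [i]) * det (A i)) * (norm X)\<^sup>2
      \<le> (norm (A i *v X))\<^sup>2 * spread r (u @ w)" by (simp add: b)
    then have 1: "(rate * spread r (u @ w @ [i]) * det (A i)) * (norm X)\<^sup>2 * (rate ^ length w * det (wprod A w) * (norm x)\<^sup>2)
      \<le> (norm (A i *v X))\<^sup>2 * spread r (u @ w) * (rate ^ length w * det (wprod A w) * (norm x)\<^sup>2)"
      using rate_gt_1 D by (intro mult_right_mono) auto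
    have IH: "rate ^ length w * spread r (u @ w) * det (wprod A w) * (norm x)\<^sup>2 \<le> (norm X)\<^sup>2 * spread r u"
      using snoc.IH[OF adw iw(1)] by (simp add: X_def)
    have "(norm (A i *v X))\<^sup>2 * (rate ^ length w * spread r (u @ w) * det (wprod A w) * (norm x)\<^sup>2)
      \<le> (norm (A i *v X))\<^sup>2 * ((norm X)\<^sup>2 * spread r u)"
      by (rule mult_left_mono[OF IH]) simp
    with 1 have 2: "(norm X)\<^sup>2 * (rate * spread r (u @ w @ [i]) * det (A i) * (rate ^ length w * det (wprod A w) * (norm x)\<^sup>2))
      \<le> (norm X)\<^sup>2 * ((norm (A i *v X))\<^sup>2 * spread r u)"
      by (simp add: mult_ac)
    have "rate * spread r (u @ w @ [i]) * det (A i) * (rate ^ length w * det (wprod A w) * (norm x)\<^sup>2)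
      \<le> (norm (A i *v X))\<^sup>2 * spread r u"
    \<comment> \<open>Cancel the square of \<open>norm X\<close>. If \<open>X\<close> is 0,
      invertibility of the word gives \<open>x = 0\<close> and the left side vanishes.\<close>
    proof (cases "X = 0")
      case True
      then have "x = 0" using D invertible_mult_nonzero[of "wprod A w" x] by (auto simp: X_def)
      then show ?thesis using True by simp
    next
      case False
      then show ?thesis using 2 by (simp add: mult_le_cancel_left_pos)
    qed
    then show ?case
      by (simp add: X_def wprod_append det_mul matrix_vector_mul_assoc mult_ac)
  qed
  have ad': "adm S E (s # u)" using ad adm_append[of S E "s # u" w] by simp
  have uw: "inv_word (u @ w)" using u w by auto
  define Q where "Q = rate ^ length w * det (wprod A w) * (norm x)\<^sup>2"
  have Q: "Q \<ge> 0" unfolding Q_def using rate_gt_1 w det_nonneg by (auto intro!: mult_nonneg_nonneg det_wprod_nonneg)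
  have "sin (2 * \<delta>) * Q \<le> spread r (u @ w) * Q"
    using spread_bounds(1)[OF ad uw r] Q by (intro mult_right_mono)
  also have "\<dots> \<le> (norm (wprod A w *v x))\<^sup>2 * spread r u" using main by (simp add: Q_def mult_ac)
  also have "\<dots> \<le> (norm (wprod A w *v x))\<^sup>2 * (2 * cot \<delta>)"
    using spread_bounds(2)[OF ad' u r] by (intro mult_left_mono) auto
  finally have "sin (2 * \<delta>) * Q / (2 * cot \<delta>) \<le> (norm (wprod A w *v x))\<^sup>2"
    using delta_pos by (simp add: pos_divide_le_eq)
  then show ?thesis by (simp add: growth_const_def Q_def mult_ac)
qed

end

section \<open>Limits of line fields\<close>

text \<open>For nonzero \<open>z\<close>, the orthogonal projection onto the line of
  \<open>z\<close>; it does not change when \<open>z\<close> is rescaled.\<close>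

definition prj :: "real^2 \<Rightarrow> real^2^2" where
  "prj z = (\<chi> i j. z $ i * z $ j / (norm z)\<^sup>2)"

lemma prj_mult_vec: "prj z *v x = ((z \<bullet> x) / (norm z)\<^sup>2) *\<^sub>R z"
  by (simp add: prj_def vec_eq_iff forall_2 mat2_vec_nth inner_vec_def sum_2 field_simps add_divide_distrib)

lemma inner_prj: "prj y \<bullet> prj z = (y \<bullet> z)\<^sup>2 / ((norm y)\<^sup>2 * (norm z)\<^sup>2)"
  by (simp add: prj_def inner_vec_def sum_2 power2_eq_square algebra_simps add_divide_distrib)

text \<open>Projectors represent lines by points of a complete space.\<close>
lemma dist_prj:
  assumes "y \<noteq> 0" "z \<noteq> 0"
  shows "(dist (prj y) (prj z))\<^sup>2 = 2 * (wed y z / (norm y * norm z))\<^sup>2"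
proof -
  have s: "prj x \<bullet> prj x = 1" if "x \<noteq> 0" for x
    using inner_prj[of x x] that by (simp only: dot_square_norm[of x]) (simp add: power2_eq_square)
  have "(dist (prj y) (prj z))\<^sup>2 = prj y \<bullet> prj y + prj z \<bullet> prj z - 2 * (prj y \<bullet> prj z)"
    by (simp add: dist_norm power2_norm_eq_inner inner_diff inner_commute)
  also have "\<dots> = 2 * (((norm y)\<^sup>2 * (norm z)\<^sup>2 - (y \<bullet> z)\<^sup>2) / ((norm y)\<^sup>2 * (norm z)\<^sup>2))"
    unfolding s[OF assms(1)] s[OF assms(2)] inner_prj[of y z] using assms by (simp add: diff_divide_distrib)
  also have "(norm y)\<^sup>2 * (norm z)\<^sup>2 - (y \<bullet> z)\<^sup>2 = (wed y z)\<^sup>2"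
    using wed_lagrange[of y z] by simp
  finally show ?thesis by (simp add: power_divide power_mult_distrib)
qed

lemma continuous_on_locally_constant:
  fixes f :: "(int \<Rightarrow> nat) \<Rightarrow> 'b::topological_space"
  assumes "finite I" "\<And>\<omega> \<omega>'. \<omega> \<in> X \<Longrightarrow> \<omega>' \<in> X \<Longrightarrow> (\<forall>i\<in>I. \<omega> i = \<omega>' i) \<Longrightarrow> f \<omega> = f \<omega>'"
  shows "continuous_on X f"
  unfolding continuous_on_topological
proof (intro ballI allI impI)
  fix \<omega> B assume w: "\<omega> \<in> X" and B: "open B" "f \<omega> \<in> B"
  define T where "T = (\<Inter>i\<in>I. (\<lambda>\<omega>'::int \<Rightarrow> nat. \<omega>' i) -` {\<omega> i})"
  have "open T" unfolding T_def using assms(1)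
    by (intro open_INT ballI open_vimage discrete_topology_class.open_discrete continuous_on_product_coordinates)
  moreover have "\<omega> \<in> T" by (simp add: T_def)
  moreover have "f y \<in> B" if "y \<in> X" "y \<in> T" for y
    using assms(2)[of \<omega> y] w that B by (auto simp: T_def)
  ultimately show "\<exists>A. open A \<and> \<omega> \<in> A \<and> (\<forall>y\<in>X. y \<in> A \<longrightarrow> f y \<in> B)" by blast
qed

text \<open>A compact image of the circle. Hence a limit of projectors onto lines is again a
  projector onto a line.\<close>

lemma closed_unit_projectors: "closed (prj ` sphere 0 1)"
proof -
  have "continuous_on (sphere 0 1) prj"
    unfolding prj_def by (intro continuous_on_vec_lambda continuous_intros) auto
  then show ?thesis by (intro compact_imp_closed compact_continuous_image compact_sphere)
qed

lemma continuous_on_mat_vec: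
  assumes "continuous_on X Q" shows "continuous_on X (\<lambda>\<omega>. (Q \<omega> :: real^2^2) *v x)"
  unfolding matrix_vector_mult_def
  by (intro continuous_on_vec_lambda continuous_intros assms)

lemma tendsto_mat_vec:
  assumes "(f \<longlongrightarrow> (v::real^2)) F" shows "((\<lambda>n. M *v f n) \<longlongrightarrow> (M::real^2^2) *v v) F"
  unfolding matrix_vector_mult_def
  by (intro tendsto_vec_lambda tendsto_intros assms)

lemma tendsto_wed:
  assumes "(f \<longlongrightarrow> x) F" "(g \<longlongrightarrow> y) F" shows "((\<lambda>n. wed (f n) (g n)) \<longlongrightarrow> wed x y) F"
  unfolding wed_def by (intro tendsto_intros assms)

lemma line_span: "v \<noteq> 0 \<Longrightarrow> line (span {v})"
  by (simp add: line_def dim_singleton)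

lemma span_scaleR: "c \<noteq> 0 \<Longrightarrow> span {c *\<^sub>R v} = span {v :: real^2}"
proof -
  assume c: "c \<noteq> 0"
  have "v = (1 / c) *\<^sub>R (c *\<^sub>R v)" using c by simp
  then have "v \<in> span {c *\<^sub>R v}" by (metis span_base span_scale singletonI)
  moreover have "c *\<^sub>R v \<in> span {v}" by (metis span_base span_scale singletonI)
  ultimately show ?thesis by (simp add: span_eq)
qed

text \<open>\<open>cau\<close> bounds the sines of the angles between approximating lines, so their
  projectors are uniformly Cauchy, and a uniform limit of locally constant maps is continuous. The
  scalars in the last conclusion let homogeneous relations pass to the limit.\<close>

lemma line_field_limit:
  fixes Z :: "nat \<Rightarrow> (int \<Rightarrow> nat) \<Rightarrow> real^2"
  assumes nz: "\<And>n \<omega>. \<omega> \<in> X \<Longrightarrow> Z n \<omega> \<noteq> 0"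
    and loc: "\<And>n \<omega> \<omega>'. \<omega> \<in> X \<Longrightarrow> \<omega>' \<in> X \<Longrightarrow> (\<forall>i\<in>{- int n..int n}. \<omega> i = \<omega>' i) \<Longrightarrow> Z n \<omega> = Z n \<omega>'"
    and cau: "\<And>n m \<omega>. \<omega> \<in> X \<Longrightarrow> n \<le> m \<Longrightarrow> \<bar>wed (Z n \<omega>) (Z m \<omega>)\<bar> \<le> e n * (norm (Z n \<omega>) * norm (Z m \<omega>))"
    and e: "e \<longlonglongrightarrow> 0"
  obtains V where "\<And>\<omega>. \<omega> \<in> X \<Longrightarrow> norm (V \<omega>) = 1" "continuous_line_field X (\<lambda>\<omega>. span {V \<omega>})"
    "\<And>\<omega>. \<omega> \<in> X \<Longrightarrow> \<exists>c. (\<lambda>n. c n *\<^sub>R Z n \<omega>) \<longlonglongrightarrow> V \<omega>"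
proof -
  define q where "q n \<omega> = prj (Z n \<omega>)" for n \<omega>
  \<comment> \<open>\<open>dist_prj\<close> yields the factor sqrt 2, rounded up to 2.\<close>
  have d: "dist (q n \<omega>) (q m \<omega>) \<le> 2 * \<bar>e n\<bar>" if "\<omega> \<in> X" "n \<le> m" for n m \<omega>
  proof -
    define W where "W = \<bar>wed (Z n \<omega>) (Z m \<omega>)\<bar> / (norm (Z n \<omega>) * norm (Z m \<omega>))"
    have "W \<le> \<bar>e n\<bar>" "W \<ge> 0"
      unfolding W_def using cau[OF that] nz[OF that(1), of n] nz[OF that(1), of m] 
      by (auto simp: divide_le_eq intro: order_trans mult_right_mono)
    then have "W\<^sup>2 \<le> (e n)\<^sup>2" by (metis power2_abs power_mono)
    moreover have "(dist (q n \<omega>) (q m \<omega>))\<^sup>2 = 2 * W\<^sup>2"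
      using dist_prj[OF nz[OF that(1), of n] nz[OF that(1), of m]] by (simp add: q_def W_def power_divide)
    ultimately have "(dist (q n \<omega>) (q m \<omega>))\<^sup>2 \<le> 4 * (e n)\<^sup>2"
      using zero_le_power2[of "e n"] by linarith
    also have "\<dots> = (2 * \<bar>e n\<bar>)\<^sup>2" by (simp add: power_mult_distrib)
    finally show ?thesis by (rule power2_le_imp_le) simp
  qed
  have "uniformly_Cauchy_on X q"
  proof (rule uniformly_Cauchy_onI')
    fix r :: real assume "r > 0"
    then have "eventually (\<lambda>n. \<bar>e n\<bar> < r / 2) sequentially"
      using tendstoD[OF e, of "r / 2"] by (simp add: dist_real_def)
    then obtain N where N: "\<And>n. n \<ge> N \<Longrightarrow> \<bar>e n\<bar> < r / 2" by (auto simp: eventually_sequentially)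
    have "dist (q m x) (q n x) < r" if "x \<in> X" "m \<ge> N" "n > m" for x m n
      using d[of x m n] N[of m] that by simp
    then show "\<exists>M. \<forall>x\<in>X. \<forall>m\<ge>M. \<forall>n>m. dist (q m x) (q n x) < r" by blast
  qed
  then obtain Q where Q: "uniform_limit X q Q sequentially"
    by (meson Cauchy_uniformly_convergent uniformly_convergent_on_def)
  have "continuous_on X (q n)" for n
  proof (rule continuous_on_locally_constant[of "{- int n..int n}"])
    fix \<omega> \<omega>' assume "\<omega> \<in> X" "\<omega>' \<in> X" "\<forall>i\<in>{- int n..int n}. \<omega> i = \<omega>' i"
    then show "q n \<omega> = q n \<omega>'" unfolding q_def by (intro arg_cong[of _ _ prj] loc)
  qed simp
  then have Qc: "continuous_on X Q"
    by (intro uniform_limit_theorem[OF _ Q]) auto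
  have lim: "(\<lambda>n. q n \<omega>) \<longlonglongrightarrow> Q \<omega>" if "\<omega> \<in> X" for \<omega>
    using tendsto_uniform_limitI[OF Q that] .
  have "\<exists>v. norm v = 1 \<and> Q \<omega> = prj v" if w: "\<omega> \<in> X" for \<omega>
  proof -
    have "q n \<omega> \<in> prj ` sphere 0 1" for n
    proof (rule image_eqI)
      show "q n \<omega> = prj ((1 / norm (Z n \<omega>)) *\<^sub>R Z n \<omega>)"
        using nz[OF w, of n] by (simp add: q_def prj_def vec_eq_iff field_simps power2_eq_square)
    qed (use nz[OF w, of n] in auto)
    then have "Q \<omega> \<in> prj ` sphere 0 1"
      by (intro closed_sequentially[OF closed_unit_projectors _ lim[OF w]])
    then show ?thesis by auto
  qed
  then obtain V where V: "\<And>\<omega>. \<omega> \<in> X \<Longrightarrow> norm (V \<omega>) = 1" "\<And>\<omega>. \<omega> \<in> X \<Longrightarrow> Q \<omega> = prj (V \<omega>)" by metis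
  have V0: "V \<omega> \<noteq> 0" if "\<omega> \<in> X" for \<omega> using V(1)[OF that] by auto
  have QV: "Q \<omega>' *v x = (V \<omega>' \<bullet> x) *\<^sub>R V \<omega>'" if "\<omega>' \<in> X" for \<omega>' x
    using V[OF that] by (simp add: prj_mult_vec)
  have "\<exists>c. (\<lambda>n. c n *\<^sub>R Z n \<omega>) \<longlonglongrightarrow> V \<omega>" if w: "\<omega> \<in> X" for \<omega>
  proof -
    have "(\<lambda>n. q n \<omega> *v V \<omega>) \<longlonglongrightarrow> Q \<omega> *v V \<omega>"
      unfolding matrix_vector_mult_def by (intro tendsto_vec_lambda tendsto_intros lim w)
    also have "Q \<omega> *v V \<omega> = V \<omega>" using QV[OF w] V(1)[OF w] by (simp add: dot_square_norm)
    \<comment> \<open>The scalars are the coefficients of the projection of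
      \<open>V \<omega>\<close> onto the approximating lines.\<close>
    finally show ?thesis unfolding q_def prj_mult_vec by (rule exI[of _ "\<lambda>n. (Z n \<omega> \<bullet> V \<omega>) / (norm (Z n \<omega>))\<^sup>2"])
  qed
  moreover have "continuous_line_field X (\<lambda>\<omega>. span {V \<omega>})"
    unfolding continuous_line_field_def
  proof (intro conjI ballI)
    fix \<omega> assume w: "\<omega> \<in> X"
    show "line (span {V \<omega>})" using V0[OF w] by (rule line_span)
    \<comment> \<open>\<open>V\<close> comes from a choice of sign at each point. Projecting the one
      fixed vector \<open>V \<omega>\<close> onto the nearby lines gives a continuous spanning field
      where it does not vanish.\<close>
    define v where "v \<omega>' = Q \<omega>' *v V \<omega>" for \<omega>'
    have vc: "continuous_on X v" unfolding v_def by (rule continuous_on_mat_vec[OF Qc])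
    define U where "U = X \<inter> v -` (- {0})"
    have "openin (top_of_set X) U" unfolding U_def
      by (intro continuous_openin_preimage_gen vc) auto
    moreover have "\<omega> \<in> U" using w V0[OF w] V(1)[OF w] by (simp add: U_def v_def QV)
    moreover have "continuous_on U v" using vc by (rule continuous_on_subset) (auto simp: U_def)
    moreover have "v \<omega>' \<noteq> 0 \<and> span {V \<omega>'} = span {v \<omega>'}" if "\<omega>' \<in> U" for \<omega>'
      using that span_scaleR[of "V \<omega>' \<bullet> V \<omega>" "V \<omega>'"] by (auto simp: U_def v_def QV)
    ultimately show "\<exists>U v. openin (top_of_set X) U \<and> \<omega> \<in> U \<and> continuous_on U v \<and>
        (\<forall>\<omega>'\<in>U. v \<omega>' \<noteq> 0 \<and> span {V \<omega>'} = span {v \<omega>'})" by blast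
  qed
  ultimately show ?thesis using that[of V] V(1) by blast
qed

section \<open>Finite windows of bi-infinite sequences\<close>

definition seg :: "(int \<Rightarrow> nat) \<Rightarrow> int \<Rightarrow> nat \<Rightarrow> nat list" where
  "seg \<omega> a n = map (\<lambda>l. \<omega> (a + int l)) [0..<n]"

lemma length_seg [simp]: "length (seg \<omega> a n) = n" by (simp add: seg_def)

lemma seg_0 [simp]: "seg \<omega> a 0 = []" by (simp add: seg_def)

lemma seg_add: "seg \<omega> a (n + m) = seg \<omega> a n @ seg \<omega> (a + int n) m"
  by (rule nth_equalityI) (auto simp: seg_def nth_append algebra_simps)

lemma seg_Suc: "seg \<omega> a (Suc n) = seg \<omega> a n @ [\<omega> (a + int n)]"
  by (simp add: seg_def)

lemma seg_Suc_Cons: "seg \<omega> a (Suc n) = \<omega> a # seg \<omega> (a + 1) n"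
  using seg_add[of \<omega> a 1 n] by (simp add: seg_Suc)

lemma seg_eq_Nil [simp]: "seg \<omega> a n = [] \<longleftrightarrow> n = 0"
  using length_seg[of \<omega> a n] by (metis length_0_conv)

lemma hd_seg: "n > 0 \<Longrightarrow> hd (seg \<omega> a n) = \<omega> a"
  by (cases n) (auto simp: seg_Suc_Cons)

lemma last_seg: "n > 0 \<Longrightarrow> last (seg \<omega> a n) = \<omega> (a + int n - 1)"
  by (cases n) (auto simp: seg_Suc)

lemma seg_shift: "seg (shift \<omega>) a n = seg \<omega> (a + 1) n"
  by (simp add: seg_def shift_def algebra_simps)

lemma seg_cong: "(\<And>i. a \<le> i \<Longrightarrow> i < a + int n \<Longrightarrow> \<omega> i = \<omega>' i) \<Longrightarrow> seg \<omega> a n = seg \<omega>' a n"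
  by (simp add: seg_def)

lemma cocycle_iter_wprod: "cocycle_iter A \<omega> n = wprod A (seg \<omega> 1 n)"
  by (induction n) (auto simp: seg_Suc wprod_append)

lemma restr_norm_span:
  assumes "norm v = 1" shows "restr_norm M (span {v}) = norm (M *v v)"
proof -
  have "{norm (M *v u) |u. u \<in> span {v} \<and> norm u = 1} = {norm (M *v v)}"
  proof -
    have "norm (M *v (k *\<^sub>R v)) = norm (M *v v)" if "norm (k *\<^sub>R v) = 1" for k
      using that assms by (simp add: matrix_vector_mult_scaleR)
    then show ?thesis using assms span_base[of v "{v}"] by (auto simp: span_singleton)
  qed
  then show ?thesis by (simp add: restr_norm_def)
qed

section \<open>Hyperbolicity without null words\<close>

context robustly_nonnull
begin

text \<open>The singular letter stands at the outer end, so that the property survives appending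
  letters on the right; for \<open>future_word\<close> the same holds on the left. The range of a
  past word and the kernel of a future word give directions.\<close>

abbreviation past_word :: "nat list \<Rightarrow> bool" where
  "past_word w \<equiv> w \<noteq> [] \<and> det (A (hd w)) = 0"

abbreviation future_word :: "nat list \<Rightarrow> bool" where
  "future_word v \<equiv> v \<noteq> [] \<and> det (A (last v)) = 0"

lemma past_word_decomp:
  assumes "adm S E w" "past_word w"
  obtains w1 s u where "w = w1 @ s # u" "det (A s) = 0" "inv_word u" "adm S E (s # u)"
proof -
  have "\<exists>s\<in>set w. det (A s) = 0" using assms(2) by (meson hd_in_set)
  then obtain w1 s u where w: "w = w1 @ s # u" "det (A s) = 0" "\<forall>i\<in>set u. det (A i) \<noteq> 0"
    using split_list_last_prop[of w "\<lambda>i. det (A i) = 0"] by blast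
  have ad: "adm S E (s # u)" using assms(1) unfolding w(1) by (simp add: adm_append)
  moreover have "inv_word u" using w(3) ad by (auto simp: adm_def)
  ultimately show ?thesis using that[OF w(1,2)] by blast
qed

lemma future_word_decomp:
  assumes "adm S E v" "future_word v"
  obtains u s v1 where "v = u @ s # v1" "det (A s) = 0" "inv_word u"
proof -
  have "\<exists>s\<in>set v. det (A s) = 0" using assms(2) by (meson last_in_set)
  then obtain u s v1 where v: "v = u @ s # v1" "det (A s) = 0" "\<forall>i\<in>set u. det (A i) \<noteq> 0"
    using split_list_first_prop[of v "\<lambda>i. det (A i) = 0"] by blast
  moreover have "inv_word u" using v(1,3) assms(1) by (auto simp: adm_def)
  ultimately show ?thesis using that by blast
qed

text \<open>The range of the singular prefix is at most a line, and the remaining word is injective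
  on it because the whole word is not null. Letters after a singular prefix thus leave the kernel
  unchanged.\<close>

lemma wprod_kernel_prefix:
  assumes "adm S E (v @ v')" "det (wprod A v) = 0" "wprod A (v @ v') *v z = 0"
  shows "wprod A v *v z = 0"
  using singular_then_injective[of "wprod A v" "wprod A v'" z] assms wprod_nonzero[of "v @ v'"]
  by (simp add: wprod_append matrix_vector_mul_assoc)

text \<open>Cut \<open>w\<close> at its last and \<open>v\<close> at its first singular letter: the
  letters outside affect neither the range line nor the kernel, and \<open>transversal_core\<close>
  treats what is left.\<close>

lemma transversal:
  assumes ad: "adm S E (w @ v)" and w: "past_word w" and v: "future_word v" and z: "wprod A v *v z = 0"
  shows "sin \<epsilon> * (norm (wprod A w *v x0) * norm z) \<le> \<bar>wed (wprod A w *v x0) z\<bar>"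
proof -
  have adw: "adm S E w" "adm S E v" using ad by (auto simp: adm_append)
  obtain w1 s u where w': "w = w1 @ s # u" "det (A s) = 0" "inv_word u"
    using past_word_decomp[OF adw(1) w] by metis
  obtain t s' v1 where v': "v = t @ s' # v1" "det (A s') = 0" "inv_word t"
    using future_word_decomp[OF adw(2) v] by metis
  have "adm S E (w1 @ (s # u @ t @ [s']) @ v1)" using ad by (simp add: w' v')
  then have ad': "adm S E (s # u @ t @ [s'])" by (simp only: adm_append[of S E w1] adm_append[of S E _ v1])
  have "wprod A (t @ [s']) *v z = 0"
    by (rule wprod_kernel_prefix[of _ v1]) (use z adw v' in \<open>auto simp: det_wprod\<close>)
  from transversal_core[OF ad' w'(2,3) v'(3) this, of "wprod A w1 *v x0"]
  show ?thesis by (simp add: w'(1) wprod_append matrix_vector_mul_assoc matrix_mul_assoc)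
qed

lemma growth:
  assumes ad: "adm S E (w @ t)" and w: "past_word w"
    and x: "x = wprod A w *v x0"
  shows "growth_const * rate ^ length t * det (wprod A t) * (norm x)\<^sup>2 \<le> (norm (wprod A t *v x))\<^sup>2"
proof (cases "\<exists>i\<in>set t. det (A i) = 0")
  case True
  \<comment> \<open>A singular letter in \<open>t\<close> makes the left side 0.\<close>
  then have "det (wprod A t) = 0" using det_wprod_eq_0 by blast
  then show ?thesis by simp
next
  case False
  have "adm S E w" using ad by (simp add: adm_append)
  then obtain w1 s u where w': "w = w1 @ s # u" "det (A s) = 0" "inv_word u"
    using past_word_decomp w by metis
  have "adm S E (w1 @ (s # u @ t))" using ad by (simp add: w')
  then have ad': "adm S E (s # u @ t)" by (simp only: adm_append[of S E w1])
  have "inv_word t" using ad False by (auto simp: adm_def)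
  from growth_core[OF ad' w'(2,3) this, of x "wprod A w1 *v x0"]
  show ?thesis by (simp add: x w'(1) wprod_append matrix_vector_mul_assoc matrix_mul_assoc)
qed

lemma det_wprod_adm: "adm S E w \<Longrightarrow> det (wprod A w) \<ge> 0"
  using det_nonneg by (intro det_wprod_nonneg) (auto simp: adm_def)

text \<open>The common word \<open>t\<close> multiplies the area of the two vectors by its
  determinant, while by \<open>growth\<close> it multiplies the product of their norms by at least
  \<open>growth_const * rate ^ length t\<close> times that determinant.\<close>

lemma past_directions_close:
  assumes ad: "adm S E (w @ t)" "adm S E (w' @ t)" and w: "past_word w" "past_word w'"
    and x: "x = wprod A (w @ t) *v x0" "x' = wprod A (w' @ t) *v x0'"
  shows "growth_const * rate ^ length t * \<bar>wed x x'\<bar> \<le> norm x * norm x'"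
proof -
  define G where "G = growth_const * rate ^ length t"
  have G: "G > 0" unfolding G_def using growth_const_pos rate_gt_1 by simp
  define D where "D = det (wprod A t)"
  have D: "D \<ge> 0" unfolding D_def using ad by (intro det_wprod_adm) (auto simp: adm_append)
  define y y' where "y = wprod A w *v x0" and "y' = wprod A w' *v x0'"
  have xy: "x = wprod A t *v y" "x' = wprod A t *v y'"
    by (simp_all add: x y_def y'_def wprod_append matrix_vector_mul_assoc)
  have g: "G * D * (norm y)\<^sup>2 \<le> (norm x)\<^sup>2" "G * D * (norm y')\<^sup>2 \<le> (norm x')\<^sup>2"
    unfolding xy G_def D_def by (rule growth[OF ad(1) w(1) y_def] growth[OF ad(2) w(2) y'_def])+
  have "(G * D * (norm y * norm y'))\<^sup>2 = (G * D * (norm y)\<^sup>2) * (G * D * (norm y')\<^sup>2)"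
    by (simp add: power2_eq_square mult_ac)
  also have "\<dots> \<le> (norm x)\<^sup>2 * (norm x')\<^sup>2" using g G D by (intro mult_mono) auto
  finally have "(G * D * (norm y * norm y'))\<^sup>2 \<le> (norm x * norm x')\<^sup>2" by (simp add: power_mult_distrib)
  then have "G * D * (norm y * norm y') \<le> norm x * norm x'" by (rule power2_le_imp_le) simp
  moreover have "\<bar>wed x x'\<bar> \<le> D * (norm y * norm y')"
    unfolding xy wed_matrix D_def[symmetric] using D wed_le[of y y'] by (simp add: abs_mult mult_left_mono)
  then have "G * \<bar>wed x x'\<bar> \<le> G * (D * (norm y * norm y'))" using G by (intro mult_left_mono) auto
  ultimately show ?thesis by (simp add: G_def mult_ac)
qed

text \<open>With \<open>B = wprod A t\<close>, transversality after \<open>t\<close> bounds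
  \<open>norm (B *v x) * norm (B *v z)\<close> by
  \<open>D * (norm x * norm z) / sin \<epsilon>\<close>, and \<open>growth\<close> bounds
  \<open>D * (norm x)\<^sup>2\<close> by the square of \<open>norm (B *v x)\<close>. Eliminating
  \<open>D\<close> gives the first claim, eliminating \<open>norm (B *v x)\<close> the
  second.\<close>

lemma domination:
  assumes ad: "adm S E (w @ t @ v)" and w: "past_word w" and v: "future_word v"
    and x: "x = wprod A w *v x0" and z: "wprod A (t @ v) *v z = 0"
  shows "growth_const * rate ^ length t * sin \<epsilon> * (norm (wprod A t *v z) * norm x)
      \<le> norm (wprod A t *v x) * norm z" (is ?dom)
    and "x \<noteq> 0 \<Longrightarrow> growth_const * rate ^ length t * (sin \<epsilon>)\<^sup>2 * (norm (wprod A t *v z))\<^sup>2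
      \<le> det (wprod A t) * (norm z)\<^sup>2"
proof -
  define G where "G = growth_const * rate ^ length t"
  have G: "G > 0" unfolding G_def using growth_const_pos rate_gt_1 by simp
  have se: "sin \<epsilon> > 0" using eps by (intro sin_gt_zero) auto
  define B where "B = wprod A t"
  define D where "D = det B"
  have adt: "adm S E t" "adm S E (w @ t)"
    using ad adm_append[of S E "w @ t" v] by (auto simp: adm_append[of S E w t])
  have D: "D \<ge> 0" unfolding D_def B_def by (rule det_wprod_adm[OF adt(1)])
  have g: "G * D * (norm x)\<^sup>2 \<le> (norm (B *v x))\<^sup>2"
    unfolding G_def D_def B_def by (rule growth[OF adt(2) w x])
  have wt: "past_word (w @ t)" using w by simp
  have "B *v x = wprod A (w @ t) *v x0" by (simp add: B_def x wprod_append matrix_vector_mul_assoc)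
  moreover have "wprod A v *v (B *v z) = 0" using z by (simp add: B_def wprod_append matrix_vector_mul_assoc)
  ultimately have "sin \<epsilon> * (norm (B *v x) * norm (B *v z)) \<le> \<bar>wed (B *v x) (B *v z)\<bar>"
    using transversal[of "w @ t" v "B *v z" x0] ad wt v by simp
  also have "\<dots> \<le> D * (norm x * norm z)"
    using D wed_le[of x z] by (simp add: wed_matrix D_def abs_mult mult_left_mono)
  finally have T: "sin \<epsilon> * (norm (B *v x) * norm (B *v z)) \<le> D * (norm x * norm z)" .
  have "(G * sin \<epsilon> * (norm (B *v z) * norm x)) * norm (B *v x) = G * norm x * (sin \<epsilon> * (norm (B *v x) * norm (B *v z)))"
    by (simp add: mult_ac)
  also have "\<dots> \<le> G * norm x * (D * (norm x * norm z))" using T G by (intro mult_left_mono) auto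
  also have "\<dots> = (G * D * (norm x)\<^sup>2) * norm z" by (simp add: power2_eq_square mult_ac)
  also have "\<dots> \<le> (norm (B *v x))\<^sup>2 * norm z" by (rule mult_right_mono[OF g]) simp
  finally have 1: "(G * sin \<epsilon> * (norm (B *v z) * norm x)) * norm (B *v x) \<le> (norm (B *v x) * norm z) * norm (B *v x)"
    by (simp add: power2_eq_square mult_ac)
  \<comment> \<open>If \<open>t\<close> is singular, the kernel of \<open>t @ v\<close> is already
    killed by \<open>t\<close>, so both claims become trivial.\<close>
  have dz: "B *v z = 0" if "D = 0"
    using wprod_kernel_prefix[of t v z] that z ad by (simp add: adm_append D_def B_def)
  have dx: "D = 0 \<or> x = 0" if "B *v x = 0"
    using that invertible_mult_nonzero[of B x] by (auto simp: D_def)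
  show ?dom
  proof (cases "B *v x = 0")
    case True
    with dx dz show ?thesis by (auto simp: G_def[symmetric] B_def[symmetric])
  next
    case False
    with 1 show ?thesis by (simp add: G_def[symmetric] B_def[symmetric] mult_le_cancel_right)
  qed
  assume x0: "x \<noteq> 0"
  have "(sin \<epsilon> * (norm (B *v x) * norm (B *v z)))\<^sup>2 \<le> (D * (norm x * norm z))\<^sup>2"
    using T se by (intro power_mono) auto
  then have "(norm (B *v x))\<^sup>2 * ((sin \<epsilon>)\<^sup>2 * (norm (B *v z))\<^sup>2) \<le> D\<^sup>2 * ((norm x)\<^sup>2 * (norm z)\<^sup>2)"
    by (simp add: power_mult_distrib mult_ac)
  moreover have "(G * D * (norm x)\<^sup>2) * ((sin \<epsilon>)\<^sup>2 * (norm (B *v z))\<^sup>2) \<le> (norm (B *v x))\<^sup>2 * ((sin \<epsilon>)\<^sup>2 * (norm (B *v z))\<^sup>2)"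
    by (rule mult_right_mono[OF g]) simp
  ultimately have 2: "(D * (norm x)\<^sup>2) * (G * (sin \<epsilon>)\<^sup>2 * (norm (B *v z))\<^sup>2) \<le> (D * (norm x)\<^sup>2) * (D * (norm z)\<^sup>2)"
    by (simp add: power2_eq_square mult_ac)
  show "growth_const * rate ^ length t * (sin \<epsilon>)\<^sup>2 * (norm (wprod A t *v z))\<^sup>2
      \<le> det (wprod A t) * (norm z)\<^sup>2"
  proof (cases "D = 0")
    case True
    with dz show ?thesis by (simp add: B_def[symmetric] D_def[symmetric])
  next
    case False
    then have "D * (norm x)\<^sup>2 > 0" using D x0 by simp
    with 2 show ?thesis by (simp add: G_def[symmetric] B_def[symmetric] D_def[symmetric] mult_le_cancel_left_pos)
  qed
qed

text \<open>By \<open>domination\<close> the word \<open>t\<close> shrinks both vectors strongly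
  relative to the square root of its determinant, while their area is scaled by the determinant
  exactly. So the area must be small from the start; if \<open>t\<close> is singular, both vectors
  lie in one kernel line.\<close>

lemma future_directions_close:
  assumes ad: "adm S E (w @ t @ v)" "adm S E (w @ t @ v')" and w: "past_word w"
    and v: "future_word v" "future_word v'"
    and z: "wprod A (t @ v) *v z = 0" "wprod A (t @ v') *v z' = 0"
  shows "growth_const * rate ^ length t * (sin \<epsilon>)\<^sup>2 * \<bar>wed z z'\<bar> \<le> norm z * norm z'"
proof -
  have "adm S E w" using ad by (auto simp: adm_append)
  then obtain x0 where x0: "wprod A w *v x0 \<noteq> 0" using wprod_nonzero mat_nonzero_obtain by metis
  define G where "G = growth_const * rate ^ length t * (sin \<epsilon>)\<^sup>2"
  have G: "G \<ge> 0" unfolding G_def using growth_const_pos rate_gt_1 by simp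
  define B where "B = wprod A t"
  define D where "D = det B"
  have D: "D \<ge> 0" unfolding D_def B_def using ad by (intro det_wprod_adm) (auto simp: adm_append)
  have h: "G * (norm (B *v z))\<^sup>2 \<le> D * (norm z)\<^sup>2" "G * (norm (B *v z'))\<^sup>2 \<le> D * (norm z')\<^sup>2"
    unfolding G_def D_def B_def
    by (rule domination(2)[OF ad(1) w v(1) refl z(1) x0] domination(2)[OF ad(2) w v(2) refl z(2) x0])+
  show ?thesis
  proof (cases "D = 0")
    case True
    have "B *v z = 0" "B *v z' = 0"
      using wprod_kernel_prefix[of t v z] wprod_kernel_prefix[of t v' z'] True ad z
      by (simp_all add: adm_append D_def B_def)
    moreover have "B \<noteq> 0" unfolding B_def using ad by (intro wprod_nonzero) (auto simp: adm_append)
    ultimately have "wed z z' = 0" by (intro kernel_parallel[of B])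
    then show ?thesis by simp
  next
    case False
    have "(G * (norm (B *v z) * norm (B *v z')))\<^sup>2 = (G * (norm (B *v z))\<^sup>2) * (G * (norm (B *v z'))\<^sup>2)"
      by (simp add: power2_eq_square mult_ac)
    also have "\<dots> \<le> (D * (norm z)\<^sup>2) * (D * (norm z')\<^sup>2)" by (rule mult_mono[OF h]) (use G D in auto)
    also have "\<dots> = (D * (norm z * norm z'))\<^sup>2" by (simp add: power2_eq_square mult_ac)
    finally have "G * (norm (B *v z) * norm (B *v z')) \<le> D * (norm z * norm z')"
      by (rule power2_le_imp_le) (use D in simp)
    moreover have "D * \<bar>wed z z'\<bar> \<le> norm (B *v z) * norm (B *v z')"
      using wed_le[of "B *v z" "B *v z'"] D by (simp add: wed_matrix D_def abs_mult)
    then have "G * (D * \<bar>wed z z'\<bar>) \<le> G * (norm (B *v z) * norm (B *v z'))"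
      using G by (intro mult_left_mono) auto
    ultimately have "D * (G * \<bar>wed z z'\<bar>) \<le> D * (norm z * norm z')" by (simp add: mult_ac)
    then show ?thesis using False D by (simp add: G_def mult_le_cancel_left)
  qed
qed

section \<open>Approximate invariant directions along a sequence\<close>

lemma wprod_past_nonzero: "adm S E w \<Longrightarrow> \<exists>z. z \<noteq> 0 \<and> (\<exists>x. z = wprod A w *v x)"
  using wprod_nonzero mat_nonzero_obtain by metis

lemma wprod_future_kernel: "future_word v \<Longrightarrow> \<exists>z. z \<noteq> 0 \<and> wprod A v *v z = 0"
  using det_wprod_eq_0[of "last v" v A] singular_kernel by (metis last_in_set)

text \<open>A fixed singular past for each letter replaces the infinite past of a sequence, so that
  the approximating directions depend on finitely many coordinates.\<close>

definition past :: "nat \<Rightarrow> nat list" where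
  "past j = (SOME w. adm S E (w @ [j]) \<and> past_word w)"

definition future :: "nat \<Rightarrow> nat list" where
  "future j = (SOME v. adm S E (j # v) \<and> future_word v)"

lemma past: "j \<in> S \<Longrightarrow> adm S E (past j @ [j]) \<and> past_word (past j)"
  unfolding past_def
proof (rule someI_ex)
  assume j: "j \<in> S"
  obtain s where s: "s \<in> S" "det (A s) = 0" using singular_letter by blast
  obtain w where "adm S E (s # w @ [j])" using connected[OF s(1) j] by blast
  then show "\<exists>w. adm S E (w @ [j]) \<and> past_word w" using s by (intro exI[of _ "s # w"]) auto
qed

lemma future: "j \<in> S \<Longrightarrow> adm S E (j # future j) \<and> future_word (future j)"
  unfolding future_def
proof (rule someI_ex)
  assume j: "j \<in> S"
  obtain s where s: "s \<in> S" "det (A s) = 0" using singular_letter by blast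
  obtain w where "adm S E (j # w @ [s])" using connected[OF j s(1)] by blast
  then show "\<exists>v. adm S E (j # v) \<and> future_word v" using s by (intro exI[of _ "w @ [s]"]) auto
qed

definition subshift :: "(int \<Rightarrow> nat) set" where
  "subshift = {\<omega>. (\<forall>n. \<omega> n \<in> S) \<and> (\<forall>n. E (\<omega> n) (\<omega> (n + 1)))}"

lemma subshift_letter: "\<omega> \<in> subshift \<Longrightarrow> \<omega> n \<in> S" by (simp add: subshift_def)

lemma adm_seg: "\<omega> \<in> subshift \<Longrightarrow> adm S E (seg \<omega> a n)"
proof (induction n)
  case (Suc n)
  have "E (\<omega> (a + int n - 1)) (\<omega> (a + int n - 1 + 1))" using Suc.prems unfolding subshift_def by blast
  with Suc show ?case by (cases "n = 0") (auto simp: seg_Suc adm_append last_seg subshift_letter)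
qed simp

lemma adm_past_seg: "\<omega> \<in> subshift \<Longrightarrow> n > 0 \<Longrightarrow> adm S E (past (\<omega> a) @ seg \<omega> a n)"
  using past[OF subshift_letter, of \<omega> a] adm_seg[of \<omega> a n] by (auto simp: adm_append hd_seg)

lemma adm_seg_future: "\<omega> \<in> subshift \<Longrightarrow> n > 0 \<Longrightarrow> adm S E (seg \<omega> a n @ future (\<omega> (a + int n - 1)))"
  using future[OF subshift_letter, of \<omega> "a + int n - 1"] adm_seg[of \<omega> a n]
  by (auto simp: adm_append last_seg adm_Cons)

lemma adm_past_seg_future:
  "\<omega> \<in> subshift \<Longrightarrow> n > 0 \<Longrightarrow> adm S E (past (\<omega> a) @ seg \<omega> a n @ future (\<omega> (a + int n - 1)))"
  using adm_past_seg[of \<omega> n a] adm_seg_future[of \<omega> n a] by (auto simp: adm_append[of S E "past (\<omega> a)"])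

text \<open>The past ends at coordinate 0 because the first cocycle step applies letter 1. For
  \<open>n = 0\<close>, \<open>future_seg\<close> continues directly after letter 0, so the two
  always concatenate admissibly.\<close>

definition past_seg :: "nat \<Rightarrow> (int \<Rightarrow> nat) \<Rightarrow> nat list" where
  "past_seg n \<omega> = past (\<omega> (- int n)) @ seg \<omega> (- int n) (Suc n)"

definition future_seg :: "nat \<Rightarrow> (int \<Rightarrow> nat) \<Rightarrow> nat list" where
  "future_seg n \<omega> = seg \<omega> 1 n @ future (\<omega> (int n))"

text \<open>The choice depends on the word alone, hence is constant on cylinders; the same holds for
  \<open>stable\<close>.\<close>

definition unstable :: "nat \<Rightarrow> (int \<Rightarrow> nat) \<Rightarrow> real^2" where
  "unstable n \<omega> = (SOME z. z \<noteq> 0 \<and> (\<exists>x. z = wprod A (past_seg n \<omega>) *v x))"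

definition stable :: "nat \<Rightarrow> (int \<Rightarrow> nat) \<Rightarrow> real^2" where
  "stable n \<omega> = (SOME z. z \<noteq> 0 \<and> wprod A (future_seg n \<omega>) *v z = 0)"

context
  fixes \<omega> :: "int \<Rightarrow> nat"
  assumes om: "\<omega> \<in> subshift"
begin

lemma past_seg_adm: "adm S E (past_seg n \<omega>)" "past_word (past_seg n \<omega>)"
  unfolding past_seg_def using adm_past_seg[OF om] past[OF subshift_letter[OF om]] by auto

lemma past_future_adm: "adm S E (past_seg m \<omega> @ future_seg n \<omega>)"
  using adm_past_seg_future[OF om, of "Suc (m + n)" "- int m"] seg_add[of \<omega> "- int m" "Suc m" n]
  by (simp add: past_seg_def future_seg_def)

lemma future_seg_adm: "adm S E (future_seg n \<omega>)" "future_word (future_seg n \<omega>)"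
  using past_future_adm[of 0 n] future[OF subshift_letter[OF om]]
  by (auto simp: adm_append[of S E "past_seg 0 \<omega>"] future_seg_def)

lemma unstable: "unstable n \<omega> \<noteq> 0" "\<exists>x. unstable n \<omega> = wprod A (past_seg n \<omega>) *v x"
  using someI_ex[OF wprod_past_nonzero[OF past_seg_adm(1)]] unfolding unstable_def by auto

lemma stable: "stable n \<omega> \<noteq> 0" "wprod A (future_seg n \<omega>) *v stable n \<omega> = 0"
  using someI_ex[OF wprod_future_kernel[OF future_seg_adm(2)]] unfolding stable_def by auto

lemma unstable_close:
  assumes "n \<le> m"
  shows "growth_const * rate ^ Suc n * \<bar>wed (unstable n \<omega>) (unstable m \<omega>)\<bar> \<le> norm (unstable n \<omega>) * norm (unstable m \<omega>)"
proof -
  obtain x x' where x: "unstable n \<omega> = wprod A (past_seg n \<omega>) *v x" "unstable m \<omega> = wprod A (past_seg m \<omega>) *v x'"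
    using unstable(2) by metis
  \<comment> \<open>Both words end in the letters at coordinates \<open>-n\<close> to 0, which gives
    the exponent \<open>Suc n\<close>.\<close>
  have m: "past_seg m \<omega> = (past (\<omega> (- int m)) @ seg \<omega> (- int m) (m - n)) @ seg \<omega> (- int n) (Suc n)"
    using seg_add[of \<omega> "- int m" "m - n" "Suc n"] assms by (simp add: past_seg_def Suc_diff_le of_nat_diff)
  have "growth_const * rate ^ length (seg \<omega> (- int n) (Suc n)) * \<bar>wed (unstable n \<omega>) (unstable m \<omega>)\<bar>
      \<le> norm (unstable n \<omega>) * norm (unstable m \<omega>)"
  proof (rule past_directions_close)
    show "adm S E (past (\<omega> (- int n)) @ seg \<omega> (- int n) (Suc n))"
      using past_seg_adm(1)[of n] by (simp add: past_seg_def)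
    show "adm S E ((past (\<omega> (- int m)) @ seg \<omega> (- int m) (m - n)) @ seg \<omega> (- int n) (Suc n))"
      using past_seg_adm(1)[of m] by (simp only: m)
    show "past_word (past (\<omega> (- int n)))" "past_word (past (\<omega> (- int m)) @ seg \<omega> (- int m) (m - n))"
      using past[OF subshift_letter[OF om]] by auto
    show "unstable n \<omega> = wprod A (past (\<omega> (- int n)) @ seg \<omega> (- int n) (Suc n)) *v x"
      using x(1) by (simp only: past_seg_def)
    show "unstable m \<omega> = wprod A ((past (\<omega> (- int m)) @ seg \<omega> (- int m) (m - n)) @ seg \<omega> (- int n) (Suc n)) *v x'"
      using x(2) by (simp only: m)
  qed
  then show ?thesis by (simp only: length_seg)
qed

lemma future_seg_split:
  assumes "n \<le> m"
  shows "future_seg m \<omega> = seg \<omega> 1 n @ (seg \<omega> (1 + int n) (m - n) @ future (\<omega> (int m)))"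
    "future_word (seg \<omega> (1 + int n) (m - n) @ future (\<omega> (int m)))"
  using seg_add[of \<omega> 1 n "m - n"] assms future[OF subshift_letter[OF om]] by (simp_all add: future_seg_def)

lemma stable_close:
  assumes "n \<le> m"
  shows "growth_const * rate ^ n * (sin \<epsilon>)\<^sup>2 * \<bar>wed (stable n \<omega>) (stable m \<omega>)\<bar> \<le> norm (stable n \<omega>) * norm (stable m \<omega>)"
proof -
  note n = future_seg_split[OF order_refl, of n] and m = future_seg_split[OF assms]
  have "growth_const * rate ^ length (seg \<omega> 1 n) * (sin \<epsilon>)\<^sup>2 * \<bar>wed (stable n \<omega>) (stable m \<omega>)\<bar>
      \<le> norm (stable n \<omega>) * norm (stable m \<omega>)"
    by (rule future_directions_close[OF _ _ past_seg_adm(2) n(2) m(2)])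
      (fold n(1) m(1), (rule past_future_adm stable(2))+)
  then show ?thesis by (simp only: length_seg)
qed

lemma unstable_stable_transversal:
  "sin \<epsilon> * (norm (unstable m \<omega>) * norm (stable n \<omega>)) \<le> \<bar>wed (unstable m \<omega>) (stable n \<omega>)\<bar>"
proof -
  obtain x where "unstable m \<omega> = wprod A (past_seg m \<omega>) *v x" using unstable(2) by metis
  then show ?thesis
    using transversal[OF past_future_adm past_seg_adm(2) future_seg_adm(2) stable(2)] by metis
qed

lemma unstable_stable_domination:
  assumes "N \<le> m"
  shows "growth_const * rate ^ N * sin \<epsilon> * (norm (cocycle_iter A \<omega> N *v stable m \<omega>) * norm (unstable m \<omega>))
      \<le> norm (cocycle_iter A \<omega> N *v unstable m \<omega>) * norm (stable m \<omega>)"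
proof -
  obtain x where x: "unstable m \<omega> = wprod A (past_seg m \<omega>) *v x" using unstable(2) by metis
  note m = future_seg_split[OF assms]
  have "growth_const * rate ^ length (seg \<omega> 1 N) * sin \<epsilon> * (norm (wprod A (seg \<omega> 1 N) *v stable m \<omega>) * norm (unstable m \<omega>))
      \<le> norm (wprod A (seg \<omega> 1 N) *v unstable m \<omega>) * norm (stable m \<omega>)"
    by (rule domination(1)[OF _ past_seg_adm(2) m(2) x])
      (fold m(1), (rule past_future_adm stable(2))+)
  then show ?thesis by (simp only: length_seg cocycle_iter_wprod)
qed

lemma shift_in_subshift: "shift \<omega> \<in> subshift"
  unfolding subshift_def shift_def
proof (intro CollectI conjI allI)
  show "\<omega> (n + 1) \<in> S" for n by (rule subshift_letter[OF om])
  show "E (\<omega> (n + 1)) (\<omega> (n + 1 + 1))" for n using om unfolding subshift_def by blast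
qed

end

text \<open>The window of size \<open>Suc m\<close> of the shifted sequence is the window of size
  \<open>m\<close> with letter 1 appended, so both vectors lie in one range line. The index offset
  disappears in the limit.\<close>

lemma unstable_invariant:
  assumes om: "\<omega> \<in> subshift"
  shows "wed (A (\<omega> 1) *v unstable m \<omega>) (unstable (Suc m) (shift \<omega>)) = 0"
proof -
  obtain x where x: "unstable m \<omega> = wprod A (past_seg m \<omega>) *v x" using unstable(2)[OF om] by metis
  obtain y where y: "unstable (Suc m) (shift \<omega>) = wprod A (past_seg (Suc m) (shift \<omega>)) *v y"
    using unstable(2)[OF shift_in_subshift[OF om]] by metis
  have p: "past_seg (Suc m) (shift \<omega>) = past_seg m \<omega> @ [\<omega> 1]"
    unfolding past_seg_def seg_shift using seg_Suc[of \<omega> "- int m" "Suc m"] by (simp add: shift_def)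
  have 1: "A (\<omega> 1) *v unstable m \<omega> = wprod A (past_seg m \<omega> @ [\<omega> 1]) *v x"
    by (simp add: x wprod_append matrix_vector_mul_assoc)
  have "det (wprod A (past_seg m \<omega> @ [\<omega> 1])) = 0"
    using past_seg_adm(2)[OF om, of m] det_wprod_eq_0[of "hd (past_seg m \<omega>)"] by (metis append_is_Nil_conv hd_append2 hd_in_set)
  then show ?thesis unfolding 1 y p by (rule singular_range)
qed

text \<open>Removing letter 1 from the future window leaves that of the shifted sequence, so
  \<open>A (\<omega> 1)\<close> maps one kernel into the other, which is a line.\<close>

lemma stable_invariant:
  assumes om: "\<omega> \<in> subshift"
  shows "wed (A (\<omega> 1) *v stable (Suc m) \<omega>) (stable m (shift \<omega>)) = 0"
proof -
  have p: "future_seg (Suc m) \<omega> = \<omega> 1 # future_seg m (shift \<omega>)"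
    unfolding future_seg_def seg_shift by (simp add: seg_Suc_Cons shift_def add.commute)
  show ?thesis
  proof (rule kernel_parallel)
    show "wprod A (future_seg m (shift \<omega>)) \<noteq> 0"
      by (rule wprod_nonzero[OF future_seg_adm(1)[OF shift_in_subshift[OF om]]])
    show "wprod A (future_seg m (shift \<omega>)) *v (A (\<omega> 1) *v stable (Suc m) \<omega>) = 0"
      using stable(2)[OF om, of "Suc m"] by (simp add: p matrix_vector_mul_assoc)
    show "wprod A (future_seg m (shift \<omega>)) *v stable m (shift \<omega>) = 0"
      by (rule stable(2)[OF shift_in_subshift[OF om]])
  qed
qed

lemma invariant_limit:
  fixes z z' :: "nat \<Rightarrow> real^2"
  assumes "(\<lambda>n. c n *\<^sub>R z n) \<longlonglongrightarrow> v" "(\<lambda>n. c' n *\<^sub>R z' n) \<longlonglongrightarrow> v'" "norm v' = 1"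
    and "\<And>n. wed (M *v z n) (z' n) = 0"
  shows "(\<lambda>u. M *v u) ` span {v} \<subseteq> span {v'}"
proof -
  have "(\<lambda>n. wed (M *v (c n *\<^sub>R z n)) (c' n *\<^sub>R z' n)) \<longlonglongrightarrow> wed (M *v v) v'"
    by (intro tendsto_wed tendsto_mat_vec assms)
  moreover have "(\<lambda>n. wed (M *v (c n *\<^sub>R z n)) (c' n *\<^sub>R z' n)) = (\<lambda>n. 0)"
    by (rule ext) (simp add: matrix_vector_mult_scaleR assms(4))
  ultimately have "wed (M *v v) v' = 0" by (simp only: LIMSEQ_const_iff)
  then have "wed v' (M *v v) = 0" by (simp add: wed_def mult.commute)
  moreover have "v' \<noteq> 0" using assms(3) by auto
  ultimately obtain d where "M *v v = d *\<^sub>R v'" by (rule wed_eq_0_imp)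
  then show ?thesis
    by (auto simp: span_singleton matrix_vector_mult_scaleR)
qed

text \<open>Both sides scale by the same factor, so the inequality is insensitive to the scalars
  that normalise the approximating directions.\<close>

lemma homogeneous_limit_le:
  fixes f g :: "real^2 \<Rightarrow> real^2 \<Rightarrow> real"
  assumes "(\<lambda>n. c n *\<^sub>R x n) \<longlonglongrightarrow> v" "(\<lambda>n. c' n *\<^sub>R y n) \<longlonglongrightarrow> w"
    and "\<And>n. n \<ge> N \<Longrightarrow> f (x n) (y n) \<le> g (x n) (y n)"
    and "\<And>a b x y. f (a *\<^sub>R x) (b *\<^sub>R y) = \<bar>a * b\<bar> * f x y"
    and "\<And>a b x y. g (a *\<^sub>R x) (b *\<^sub>R y) = \<bar>a * b\<bar> * g x y"
    and "\<And>X Y. X \<longlonglongrightarrow> v \<Longrightarrow> Y \<longlonglongrightarrow> w \<Longrightarrow> (\<lambda>n. f (X n) (Y n)) \<longlonglongrightarrow> f v w"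
    and "\<And>X Y. X \<longlonglongrightarrow> v \<Longrightarrow> Y \<longlonglongrightarrow> w \<Longrightarrow> (\<lambda>n. g (X n) (Y n)) \<longlonglongrightarrow> g v w"
  shows "f v w \<le> g v w"
  by (rule LIMSEQ_le[OF assms(6)[OF assms(1,2)] assms(7)[OF assms(1,2)]])
    (use assms(3) in \<open>auto simp: assms(4,5) intro!: exI[of _ N] mult_left_mono\<close>)

lemma geometric_bound:
  assumes "C > 0" shows "(\<lambda>n. 1 / (C * rate ^ n)) \<longlonglongrightarrow> 0"
proof -
  have "(\<lambda>n. (1 / C) * (1 / rate) ^ n) \<longlonglongrightarrow> (1 / C) * 0"
    using rate_gt_1 by (intro tendsto_mult tendsto_const LIMSEQ_realpow_zero) auto
  then show ?thesis by (simp add: power_divide mult_ac)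
qed

text \<open>The closeness estimates give continuous limit fields, and transversality and domination,
  being homogeneous, pass to them. A large power of \<open>rate\<close> makes the domination
  strict.\<close>

lemma uniformly_hyperbolic: "proj_unif_hyp subshift A"
proof -
  have se: "sin \<epsilon> > 0" using eps by (intro sin_gt_zero) auto
  define C where "C = growth_const * (sin \<epsilon>)\<^sup>2"
  have C: "C > 0" using growth_const_pos se by (simp add: C_def)
  have rp: "rate ^ n > 0" for n using rate_gt_1 by simp
  obtain V where V: "\<And>\<omega>. \<omega> \<in> subshift \<Longrightarrow> norm (V \<omega>) = 1" "continuous_line_field subshift (\<lambda>\<omega>. span {V \<omega>})"
    "\<And>\<omega>. \<omega> \<in> subshift \<Longrightarrow> \<exists>c. (\<lambda>n. c n *\<^sub>R unstable n \<omega>) \<longlonglongrightarrow> V \<omega>"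
  proof (rule line_field_limit[of subshift unstable "\<lambda>n. 1 / (growth_const * rate ^ Suc n)"])
    show "unstable n \<omega> \<noteq> 0" if "\<omega> \<in> subshift" for n \<omega> by (rule unstable(1)[OF that])
    show "unstable n \<omega> = unstable n \<omega>'"
      if "\<forall>i\<in>{- int n..int n}. \<omega> i = \<omega>' i" for n \<omega> \<omega>'
    proof -
      have "seg \<omega> (- int n) (Suc n) = seg \<omega>' (- int n) (Suc n)" using that by (intro seg_cong) auto
      then have "past_seg n \<omega> = past_seg n \<omega>'" using that by (simp add: past_seg_def)
      then show ?thesis by (simp add: unstable_def)
    qed
    show "\<bar>wed (unstable n \<omega>) (unstable m \<omega>)\<bar>
       \<le> 1 / (growth_const * rate ^ Suc n) * (norm (unstable n \<omega>) * norm (unstable m \<omega>))"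
      if "\<omega> \<in> subshift" "n \<le> m" for n m \<omega>
      using unstable_close[OF that] growth_const_pos rp[of "Suc n"]
      by (simp add: pos_le_divide_eq mult_ac del: power_Suc)
    show "(\<lambda>n. 1 / (growth_const * rate ^ Suc n)) \<longlonglongrightarrow> 0"
      by (rule LIMSEQ_Suc[OF geometric_bound[OF growth_const_pos]])
  qed blast
  obtain W where W: "\<And>\<omega>. \<omega> \<in> subshift \<Longrightarrow> norm (W \<omega>) = 1" "continuous_line_field subshift (\<lambda>\<omega>. span {W \<omega>})"
    "\<And>\<omega>. \<omega> \<in> subshift \<Longrightarrow> \<exists>c. (\<lambda>n. c n *\<^sub>R stable n \<omega>) \<longlonglongrightarrow> W \<omega>"
  proof (rule line_field_limit[of subshift stable "\<lambda>n. 1 / (C * rate ^ n)"])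
    show "stable n \<omega> \<noteq> 0" if "\<omega> \<in> subshift" for n \<omega> by (rule stable(1)[OF that])
    show "stable n \<omega> = stable n \<omega>'"
      if "\<forall>i\<in>{- int n..int n}. \<omega> i = \<omega>' i" for n \<omega> \<omega>'
    proof -
      have "seg \<omega> 1 n = seg \<omega>' 1 n" using that by (intro seg_cong) auto
      then have "future_seg n \<omega> = future_seg n \<omega>'" using that by (simp add: future_seg_def)
      then show ?thesis by (simp add: stable_def)
    qed
    show "\<bar>wed (stable n \<omega>) (stable m \<omega>)\<bar>
       \<le> 1 / (C * rate ^ n) * (norm (stable n \<omega>) * norm (stable m \<omega>))"
      if "\<omega> \<in> subshift" "n \<le> m" for n m \<omega>
    proof -
      have "\<bar>wed (stable n \<omega>) (stable m \<omega>)\<bar> * (C * rate ^ n) \<le> norm (stable n \<omega>) * norm (stable m \<omega>)"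
        using stable_close[OF that] by (simp add: C_def mult_ac)
      then have "\<bar>wed (stable n \<omega>) (stable m \<omega>)\<bar> \<le> norm (stable n \<omega>) * norm (stable m \<omega>) / (C * rate ^ n)"
        using C rp[of n] by (simp only: pos_le_divide_eq mult_pos_pos)
      then show ?thesis by simp
    qed
    show "(\<lambda>n. 1 / (C * rate ^ n)) \<longlonglongrightarrow> 0" by (rule geometric_bound[OF C])
  qed blast
  have tr: "sin \<epsilon> \<le> \<bar>wed (V \<omega>) (W \<omega>)\<bar>" if om: "\<omega> \<in> subshift" for \<omega>
  proof -
    obtain c c' where c: "(\<lambda>n. c n *\<^sub>R unstable n \<omega>) \<longlonglongrightarrow> V \<omega>" "(\<lambda>n. c' n *\<^sub>R stable n \<omega>) \<longlonglongrightarrow> W \<omega>"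
      using V(3)[OF om] W(3)[OF om] by blast
    have "sin \<epsilon> * (norm (V \<omega>) * norm (W \<omega>)) \<le> \<bar>wed (V \<omega>) (W \<omega>)\<bar>"
      by (rule homogeneous_limit_le[OF c, where N = 0 and f = "\<lambda>x y. sin \<epsilon> * (norm x * norm y)" and g = "\<lambda>x y. \<bar>wed x y\<bar>"])
        (auto simp: abs_mult intro!: unstable_stable_transversal[OF om] tendsto_intros tendsto_wed)
    then show ?thesis by (simp add: V(1)[OF om] W(1)[OF om])
  qed
  have dom: "C * rate ^ N * norm (cocycle_iter A \<omega> N *v W \<omega>) \<le> norm (cocycle_iter A \<omega> N *v V \<omega>)"
    if om: "\<omega> \<in> subshift" for \<omega> N
  proof -
    let ?B = "cocycle_iter A \<omega> N"
    obtain c c' where c: "(\<lambda>n. c n *\<^sub>R unstable n \<omega>) \<longlonglongrightarrow> V \<omega>" "(\<lambda>n. c' n *\<^sub>R stable n \<omega>) \<longlonglongrightarrow> W \<omega>"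
      using V(3)[OF om] W(3)[OF om] by blast
    have "growth_const * rate ^ N * sin \<epsilon> * (norm (?B *v W \<omega>) * norm (V \<omega>)) \<le> norm (?B *v V \<omega>) * norm (W \<omega>)"
      by (rule homogeneous_limit_le[OF c, where N = N and f = "\<lambda>x y. growth_const * rate ^ N * sin \<epsilon> * (norm (?B *v y) * norm x)"
            and g = "\<lambda>x y. norm (?B *v x) * norm y"])
        (auto simp: abs_mult matrix_vector_mult_scaleR intro!: unstable_stable_domination[OF om] tendsto_intros tendsto_mat_vec)
    then have d: "growth_const * rate ^ N * sin \<epsilon> * norm (?B *v W \<omega>) \<le> norm (?B *v V \<omega>)"
      by (simp add: V(1)[OF om] W(1)[OF om])
    \<comment> \<open>One more factor \<open>sin \<epsilon> \<le> 1\<close> allows the same constant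
      \<open>C\<close> as for the convergence of the stable directions.\<close>
    have "C * rate ^ N * norm (?B *v W \<omega>) = sin \<epsilon> * (growth_const * rate ^ N * sin \<epsilon> * norm (?B *v W \<omega>))"
      by (simp add: C_def power2_eq_square mult_ac)
    also have "\<dots> \<le> 1 * (growth_const * rate ^ N * sin \<epsilon> * norm (?B *v W \<omega>))"
      using growth_const_pos se rate_gt_1 by (intro mult_right_mono) auto
    finally show ?thesis using d by simp
  qed
  obtain N where "1 / C < rate ^ N" using real_arch_pow[OF rate_gt_1] by blast
  then have N: "C * rate ^ N > 1" using C by (simp add: pos_divide_less_eq mult.commute)
  have ind: "wed (V \<omega>) (W \<omega>) \<noteq> 0" if "\<omega> \<in> subshift" for \<omega> using tr[OF that] se by auto
  show ?thesis unfolding proj_unif_hyp_def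
  proof (rule exI[of _ "\<lambda>\<omega>. span {W \<omega>}"], rule exI[of _ "\<lambda>\<omega>. span {V \<omega>}"], intro conjI ballI exI[of _ N])
    fix \<omega> assume om: "\<omega> \<in> subshift"
    note w = ind[OF om]
    have so: "shift \<omega> \<in> subshift" by (rule shift_in_subshift[OF om])
    show "{x + y |x y. x \<in> span {W \<omega>} \<and> y \<in> span {V \<omega>}} = UNIV"
    proof (rule UNIV_eq_I[symmetric], rule CollectI)
      fix u :: "real^2"
      \<comment> \<open>Cramer's rule for the coordinates of \<open>u\<close> in the basis of the
        two limit vectors.\<close>
      have "wed (V \<omega>) (W \<omega>) *\<^sub>R u = wed (V \<omega>) u *\<^sub>R W \<omega> + wed u (W \<omega>) *\<^sub>R V \<omega>"
        by (simp add: vec_eq_iff forall_2 wed_def algebra_simps)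
      then have "(1 / wed (V \<omega>) (W \<omega>)) *\<^sub>R (wed (V \<omega>) (W \<omega>) *\<^sub>R u)
          = (wed (V \<omega>) u / wed (V \<omega>) (W \<omega>)) *\<^sub>R W \<omega> + (wed u (W \<omega>) / wed (V \<omega>) (W \<omega>)) *\<^sub>R V \<omega>"
        by (simp only: scaleR_add_right scaleR_scaleR) simp
      then have "u = (wed (V \<omega>) u / wed (V \<omega>) (W \<omega>)) *\<^sub>R W \<omega> + (wed u (W \<omega>) / wed (V \<omega>) (W \<omega>)) *\<^sub>R V \<omega>"
        using w by simp
      then show "\<exists>x y. u = x + y \<and> x \<in> span {W \<omega>} \<and> y \<in> span {V \<omega>}"
        by (metis span_base span_scale singletonI)
    qed
    show "span {W \<omega>} \<inter> span {V \<omega>} = {0}"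
    proof -
      have "u = 0" if uin: "u \<in> span {W \<omega>}" "u \<in> span {V \<omega>}" for u
      proof -
        obtain a b where ab: "u = a *\<^sub>R W \<omega>" "u = b *\<^sub>R V \<omega>" using uin
          unfolding span_singleton by blast
        have "b * wed (V \<omega>) (W \<omega>) = wed u (W \<omega>)" using ab(2) by simp
        also have "\<dots> = 0" using ab(1) by simp
        finally show ?thesis using w ab by simp
      qed
      then show ?thesis by (auto simp: span_0)
    qed
    obtain c where c: "(\<lambda>n. c n *\<^sub>R stable n \<omega>) \<longlonglongrightarrow> W \<omega>" using W(3)[OF om] by blast
    obtain c' where c': "(\<lambda>n. c' n *\<^sub>R stable n (shift \<omega>)) \<longlonglongrightarrow> W (shift \<omega>)" using W(3)[OF so] by blast
    show "(*v) (A (\<omega> 1)) ` span {W \<omega>} \<subseteq> span {W (shift \<omega>)}"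
      by (rule invariant_limit[OF LIMSEQ_Suc[OF c] c' W(1)[OF so] stable_invariant[OF om]])
    obtain b where b: "(\<lambda>n. b n *\<^sub>R unstable n \<omega>) \<longlonglongrightarrow> V \<omega>" using V(3)[OF om] by blast
    obtain b' where b': "(\<lambda>n. b' n *\<^sub>R unstable n (shift \<omega>)) \<longlonglongrightarrow> V (shift \<omega>)" using V(3)[OF so] by blast
    show "(*v) (A (\<omega> 1)) ` span {V \<omega>} \<subseteq> span {V (shift \<omega>)}"
      by (rule invariant_limit[OF b LIMSEQ_Suc[OF b'] V(1)[OF so] unstable_invariant[OF om]])
    let ?B = "cocycle_iter A \<omega> N"
    \<comment> \<open>Strictness when the dominated vector is killed: a nonzero matrix cannot kill
      two independent vectors.\<close>
    have "?B \<noteq> 0" unfolding cocycle_iter_wprod by (rule wprod_nonzero[OF adm_seg[OF om]])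
    then have nz: "\<not> (?B *v V \<omega> = 0 \<and> ?B *v W \<omega> = 0)" using kernel_parallel w by blast
    have d: "C * rate ^ N * norm (?B *v W \<omega>) \<le> norm (?B *v V \<omega>)" by (rule dom[OF om])
    have "norm (?B *v W \<omega>) < norm (?B *v V \<omega>)"
    proof (cases "?B *v W \<omega> = 0")
      case True
      with nz show ?thesis by simp
    next
      case False
      then have "norm (?B *v W \<omega>) < C * rate ^ N * norm (?B *v W \<omega>)"
        using mult_strict_right_mono[OF N, of "norm (?B *v W \<omega>)"] by simp
      then show ?thesis using d by (rule less_le_trans)
    qed
    then show "restr_norm ?B (span {W \<omega>}) < restr_norm ?B (span {V \<omega>})"
      by (simp add: restr_norm_span V(1)[OF om] W(1)[OF om])
  qed (rule V(2) W(2))+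
qed

end

section \<open>Recurrence of words in Markov shifts\<close>

text \<open>The conditional probability of reading \<open>w\<close> immediately after the letter
  \<open>j\<close>.\<close>

primrec path_weight :: "(nat \<Rightarrow> nat \<Rightarrow> real) \<Rightarrow> nat \<Rightarrow> nat list \<Rightarrow> real" where
  "path_weight P j [] = 1"
| "path_weight P j (i # w) = P i j * path_weight P i w"

lemma path_weight_append: "path_weight P j (u @ v) = path_weight P j u * path_weight P (last (j # u)) v"
  by (induction u arbitrary: j) auto

lemma path_weight_prod: "path_weight P j w = (\<Prod>l<length w. P (w ! l) ((j # w) ! l))"
  by (induction w arbitrary: j) (auto simp: prod.lessThan_Suc_shift simp del: prod.lessThan_Suc)

definition words :: "nat set \<Rightarrow> nat \<Rightarrow> nat list set" where
  "words S n = {w. set w \<subseteq> S \<and> length w = n}"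

lemma finite_words: "finite S \<Longrightarrow> finite (words S n)"
  unfolding words_def by (rule finite_lists_length_eq)

lemma words_Suc: "words S (Suc n) = (\<lambda>(i, w). i # w) ` (S \<times> words S n)"
proof (intro equalityI subsetI)
  fix w assume "w \<in> words S (Suc n)"
  then obtain i v where "w = i # v" "i \<in> S" "v \<in> words S n"
    by (cases w) (auto simp: words_def)
  then show "w \<in> (\<lambda>(i, w). i # w) ` (S \<times> words S n)"
    by (intro image_eqI[of _ _ "(i, v)"]) simp_all
qed (auto simp: words_def)

lemma seg_eq_iff: "seg \<omega> m (length w) = w \<longleftrightarrow> (\<forall>l<length w. \<omega> (m + int l) = w ! l)"
  by (subst list_eq_iff_nth_eq) (simp add: seg_def)

lemma seg_words: "(\<And>i. \<omega> i \<in> S) \<Longrightarrow> seg \<omega> a n \<in> words S n"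
  by (auto simp: words_def seg_def)

locale markov =
  fixes k :: nat and P :: "nat \<Rightarrow> nat \<Rightarrow> real" and q :: "nat \<Rightarrow> real"
    and X :: "(int \<Rightarrow> nat) set" and \<mu> :: "(int \<Rightarrow> nat) measure"
  assumes markov: "markov_shift k P q X \<mu>"
begin

definition S :: "nat set" where "S = {1..k}"

abbreviation step :: "nat \<Rightarrow> nat \<Rightarrow> bool" where "step j i \<equiv> P i j > 0"

sublocale prob_space \<mu>
  using markov unfolding markov_shift_def by blast

lemma P_nonneg: "i \<in> S \<Longrightarrow> j \<in> S \<Longrightarrow> P i j \<ge> 0"
  using markov by (simp add: S_def markov_shift_def primitive_matrix_def)

lemma P_sum: "j \<in> S \<Longrightarrow> (\<Sum>i\<in>S. P i j) = 1"
  using markov unfolding markov_shift_def S_def by blast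

lemma q_nonneg: "i \<in> S \<Longrightarrow> q i \<ge> 0" and q_sum: "(\<Sum>i\<in>S. q i) = 1"
  using markov unfolding markov_shift_def S_def by blast+

lemma finite_S [simp]: "finite S"
  by (simp add: S_def)

lemma X_eq: "X = {\<omega>. (\<forall>n. \<omega> n \<in> S) \<and> (\<forall>n. step (\<omega> n) (\<omega> (n + 1)))}"
  using markov unfolding markov_shift_def S_def by blast

lemma coordinate_measurable [measurable]: "(\<lambda>\<omega>. \<omega> i) \<in> measurable \<mu> (count_space UNIV)"
proof -
  have "sets \<mu> = sets (PiM UNIV (\<lambda>_. count_space UNIV))"
    using markov unfolding markov_shift_def seq_space_def by blast
  moreover have "(\<lambda>\<omega>. \<omega> i) \<in> measurable (PiM UNIV (\<lambda>_. count_space UNIV)) (count_space UNIV)"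
    by (rule measurable_component_singleton) simp
  ultimately show ?thesis by (simp cong: measurable_cong_sets)
qed

definition cyl :: "int \<Rightarrow> nat list \<Rightarrow> (int \<Rightarrow> nat) set" where
  "cyl m w = {\<omega> \<in> space \<mu>. seg \<omega> m (length w) = w}"

lemma cyl_sets [measurable]: "cyl m w \<in> sets \<mu>"
  unfolding cyl_def seg_eq_iff by measurable

lemma measure_cyl:
  assumes "j \<in> S" "set w \<subseteq> S"
  shows "measure \<mu> (cyl m (j # w)) = q j * path_weight P j w"
proof -
  define f where "f l = (j # w) ! l" for l
  have f: "\<forall>l\<le>length w. f l \<in> S"
  proof (intro allI impI)
    fix l assume "l \<le> length w"
    then have "f l \<in> set (j # w)" unfolding f_def by (intro nth_mem) simp
    then show "f l \<in> S" using assms by auto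
  qed
  have "cyl m (j # w) = {\<omega> \<in> space \<mu>. \<forall>l\<le>length w. \<omega> (m + int l) = f l}"
    unfolding cyl_def seg_eq_iff by (simp add: f_def less_Suc_eq_le)
  also have "measure \<mu> \<dots> = q (f 0) * (\<Prod>l\<in>{1..length w}. P (f l) (f (l - 1)))"
    using markov f unfolding markov_shift_def S_def by blast
  also have "(\<Prod>l\<in>{1..length w}. P (f l) (f (l - 1))) = path_weight P j w"
    by (simp add: prod.atLeast1_atMost_eq path_weight_prod f_def)
  finally show ?thesis by (simp add: f_def)
qed

lemma path_weight_nonneg: "j \<in> S \<Longrightarrow> set w \<subseteq> S \<Longrightarrow> path_weight P j w \<ge> 0"
  by (induction w arbitrary: j) (auto simp: P_nonneg)

lemma path_weight_pos_iff:
  "j \<in> S \<Longrightarrow> set w \<subseteq> S \<Longrightarrow> path_weight P j w > 0 \<longleftrightarrow> adm S step (j # w)"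
proof (induction w arbitrary: j)
  case (Cons i w)
  have "P i j \<ge> 0" "path_weight P i w \<ge> 0" using Cons.prems by (auto intro!: P_nonneg path_weight_nonneg)
  then have "path_weight P j (i # w) > 0 \<longleftrightarrow> P i j > 0 \<and> path_weight P i w > 0"
    by (auto simp: zero_less_mult_iff)
  then show ?case using Cons by (auto simp: adm_Cons[of S _ j])
qed simp

lemma path_weight_total: "j \<in> S \<Longrightarrow> (\<Sum>w\<in>words S n. path_weight P j w) = 1"
proof (induction n arbitrary: j)
  case 0
  have "words S 0 = {[]}" by (auto simp: words_def)
  then show ?case by simp
next
  case (Suc n)
  have "(\<Sum>w\<in>words S (Suc n). path_weight P j w) = (\<Sum>(i, w)\<in>S \<times> words S n. P i j * path_weight P i w)"
    unfolding words_Suc by (subst sum.reindex) (auto simp: inj_on_def case_prod_unfold)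
  also have "\<dots> = (\<Sum>i\<in>S. P i j * (\<Sum>w\<in>words S n. path_weight P i w))"
    by (simp add: sum.cartesian_product[symmetric] sum_distrib_left)
  also have "\<dots> = (\<Sum>i\<in>S. P i j)" using Suc.IH by simp
  finally show ?case using P_sum Suc.prems by simp
qed

lemma mat_pow_Suc: "mat_pow_entry k P (Suc N) i j = (\<Sum>l\<in>S. P i l * mat_pow_entry k P N l j)"
  by (simp add: S_def)

lemma mat_pow_nonneg: "i \<in> S \<Longrightarrow> j \<in> S \<Longrightarrow> mat_pow_entry k P N i j \<ge> 0"
  by (induction N arbitrary: i) (auto simp: mat_pow_Suc simp del: mat_pow_entry.simps(2) intro!: sum_nonneg mult_nonneg_nonneg P_nonneg)

text \<open>An entry of the \<open>N\<close>-th power sums the weights of all paths of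
  \<open>N\<close> steps from \<open>j\<close> to \<open>i\<close>, so a positive entry contains a
  path of positive weight.\<close>

lemma path_of_mat_pow:
  "i \<in> S \<Longrightarrow> j \<in> S \<Longrightarrow> mat_pow_entry k P N i j > 0 \<Longrightarrow>
    \<exists>c. length c = N \<and> set c \<subseteq> S \<and> last (j # c) = i \<and> path_weight P j c > 0"
proof (induction N arbitrary: i)
  case 0
  then show ?case by (auto split: if_splits)
next
  case (Suc N)
  have "\<exists>l\<in>S. P i l * mat_pow_entry k P N l j > 0"
  proof (rule ccontr)
    assume "\<not> ?thesis"
    then have "mat_pow_entry k P (Suc N) i j \<le> 0" by (auto simp: not_less mat_pow_Suc simp del: mat_pow_entry.simps(2) intro!: sum_nonpos)
    with Suc.prems show False by simp
  qed
  then obtain l where l: "l \<in> S" "P i l * mat_pow_entry k P N l j > 0" by blast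
  have "P i l \<ge> 0" "mat_pow_entry k P N l j \<ge> 0" using P_nonneg mat_pow_nonneg l(1) Suc.prems by auto
  then have p: "P i l > 0" "mat_pow_entry k P N l j > 0" using l(2) by (auto simp: zero_less_mult_iff)
  obtain c where "length c = N" "set c \<subseteq> S" "last (j # c) = l" "path_weight P j c > 0"
    using Suc.IH[OF l(1) Suc.prems(2) p(2)] by blast
  then show ?case using p(1) Suc.prems(1)
    by (intro exI[of _ "c @ [i]"]) (auto simp: path_weight_append)
qed

lemma primitive_paths:
  obtains N where "N \<ge> 1"
    "\<And>i j. i \<in> S \<Longrightarrow> j \<in> S \<Longrightarrow> \<exists>c. length c = N \<and> set c \<subseteq> S \<and> last (j # c) = i \<and> path_weight P j c > 0"
proof -
  have "\<exists>N\<ge>1. \<forall>i\<in>S. \<forall>j\<in>S. mat_pow_entry k P N i j > 0"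
    using markov unfolding markov_shift_def primitive_matrix_def S_def by blast
  then obtain N where "N \<ge> 1" "\<And>i j. i \<in> S \<Longrightarrow> j \<in> S \<Longrightarrow> mat_pow_entry k P N i j > 0" by blast
  then show ?thesis using that path_of_mat_pow by metis
qed

lemma step_connected:
  assumes "i \<in> S" "j \<in> S" shows "\<exists>w. adm S step (i # w @ [j])"
proof -
  obtain N where N: "N \<ge> 1"
    "\<And>i j. i \<in> S \<Longrightarrow> j \<in> S \<Longrightarrow> \<exists>c. length c = N \<and> set c \<subseteq> S \<and> last (j # c) = i \<and> path_weight P j c > 0"
    using primitive_paths by blast
  obtain c where c: "length c = N" "set c \<subseteq> S" "last (i # c) = j" "path_weight P i c > 0"
    using N(2)[OF assms(2,1)] by blast
  then have "c = butlast c @ [j]" using N(1) by (metis append_butlast_last_id last_ConsR list.size(3) not_one_le_zero)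
  moreover have "adm S step (i # c)" using c path_weight_pos_iff[OF assms(1) c(2)] by simp
  ultimately show ?thesis by metis
qed

section \<open>Almost sure occurrence of admissible words\<close>

lemma letters_AE: "AE \<omega> in \<mu>. \<forall>i. \<omega> i \<in> S"
proof (subst AE_all_countable, intro allI)
  fix i :: int
  \<comment> \<open>The underlying space contains all sequences of naturals, but the one-letter
    cylinders over \<open>S\<close> already carry mass 1.\<close>
  have "measure \<mu> (\<Union>j\<in>S. cyl i [j]) = (\<Sum>j\<in>S. measure \<mu> (cyl i [j]))"
  proof (rule finite_measure_finite_Union)
    show "disjoint_family_on (\<lambda>j. cyl i [j]) S" by (auto simp: disjoint_family_on_def cyl_def)
  qed auto
  also have "\<dots> = (\<Sum>j\<in>S. q j)" by (rule sum.cong) (auto simp: measure_cyl)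
  finally have "prob (\<Union>j\<in>S. cyl i [j]) = 1" using q_sum by simp
  then have "AE \<omega> in \<mu>. \<omega> \<in> (\<Union>j\<in>S. cyl i [j])" by (rule prob_eq_1[THEN iffD1, rotated]) auto
  then show "AE \<omega> in \<mu>. \<omega> i \<in> S" by eventually_elim (auto simp: cyl_def seg_def)
qed

text \<open>Concatenations of \<open>n\<close> blocks from \<open>B\<close>; with \<open>B\<close> the blocks that miss a given word at a fixed
  position, their total weight decays geometrically.\<close>
primrec blocks :: "nat list set \<Rightarrow> nat \<Rightarrow> nat list set" where
  "blocks B 0 = {[]}"
| "blocks B (Suc n) = (\<lambda>(b, r). b @ r) ` (B \<times> blocks B n)"

lemma blocks_words: "B \<subseteq> words S T \<Longrightarrow> r \<in> blocks B n \<Longrightarrow> set r \<subseteq> S"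
proof (induction n arbitrary: r)
  case (Suc n)
  then obtain b r' where "r = b @ r'" "b \<in> B" "r' \<in> blocks B n" by auto
  with Suc show ?case by (auto simp: words_def)
qed simp

lemma finite_blocks: "finite B \<Longrightarrow> finite (blocks B n)"
  by (induction n) auto

text \<open>Peel off the first block: the rest starts from the last letter reached, which lies in
  \<open>S\<close>, so the bound \<open>c\<close> applies uniformly.\<close>

lemma blocks_weight:
  assumes B: "B \<subseteq> words S T" and c: "\<And>j. j \<in> S \<Longrightarrow> (\<Sum>b\<in>B. path_weight P j b) \<le> c" "c \<ge> 0"
  shows "j \<in> S \<Longrightarrow> (\<Sum>r\<in>blocks B n. path_weight P j r) \<le> c ^ n"
proof (induction n arbitrary: j)
  case 0
  then show ?case by simp
next
  case (Suc n)
  \<comment> \<open>All blocks have length \<open>T\<close>, so a concatenation determines its first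
    block.\<close>
  have inj: "inj_on (\<lambda>(b, r). b @ r) (B \<times> blocks B n)"
  proof (rule inj_onI)
    fix x y assume x: "x \<in> B \<times> blocks B n" and y: "y \<in> B \<times> blocks B n"
      and e: "(case x of (b, r) \<Rightarrow> b @ r) = (case y of (b, r) \<Rightarrow> b @ r)"
    have "fst x \<in> words S T" "fst y \<in> words S T" using x y B by auto
    then have "length (fst x) = length (fst y)" by (simp add: words_def)
    then show "x = y" using e by (auto simp: case_prod_unfold prod_eq_iff)
  qed
  have last: "last (j # b) \<in> S" if "b \<in> B" for b
    using subsetD[OF B that] Suc.prems last_in_set[of b] by (auto simp: words_def)
  have "(\<Sum>r\<in>blocks B (Suc n). path_weight P j r) = (\<Sum>(b, r)\<in>B \<times> blocks B n. path_weight P j (b @ r))"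
    unfolding blocks.simps sum.reindex[OF inj] by (simp add: case_prod_unfold)
  also have "\<dots> = (\<Sum>b\<in>B. path_weight P j b * (\<Sum>r\<in>blocks B n. path_weight P (last (j # b)) r))"
    by (simp only: sum.cartesian_product[symmetric] path_weight_append sum_distrib_left)
  also have "\<dots> \<le> (\<Sum>b\<in>B. path_weight P j b * c ^ n)"
    using Suc.IH[OF last] B Suc.prems
    by (intro sum_mono mult_left_mono path_weight_nonneg) (auto simp: words_def)
  also have "\<dots> \<le> c * c ^ n"
    unfolding sum_distrib_right[symmetric] using c Suc.prems by (intro mult_right_mono) auto
  finally show ?case by simp
qed

text \<open>By primitivity a block of length \<open>T\<close>, entered from any letter, contains
  \<open>w\<close> at its end with probability at least \<open>d > 0\<close>. Missing it in
  \<open>n\<close> successive blocks has probability at most \<open>(1 - d) ^ n\<close>.\<close>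

lemma word_occurs_AE:
  assumes w: "adm S step w" "w \<noteq> []"
  shows "AE \<omega> in \<mu>. \<exists>a::nat. seg \<omega> (1 + int a) (length w) = w"
proof -
  obtain w0 w' where w': "w = w0 # w'" using w(2) by (cases w) auto
  have wS: "w0 \<in> S" "set w' \<subseteq> S" using w(1) by (auto simp: adm_def w')
  obtain N where N: "N \<ge> 1"
    "\<And>i j. i \<in> S \<Longrightarrow> j \<in> S \<Longrightarrow> \<exists>c. length c = N \<and> set c \<subseteq> S \<and> last (j # c) = i \<and> path_weight P j c > 0"
    using primitive_paths by blast
  \<comment> \<open>\<open>N\<close> steps lead to the first letter of \<open>w\<close> and the
    other letters follow; hence \<open>w\<close> begins at index \<open>N - 1\<close> of the
    block.\<close>
  define T where "T = N + length w'"
  have hit: "\<exists>b\<in>words S T. drop (N - 1) b = w \<and> path_weight P j b > 0" if j: "j \<in> S" for j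
  proof -
    obtain c where c: "length c = N" "set c \<subseteq> S" "last (j # c) = w0" "path_weight P j c > 0"
      using N(2)[OF wS(1) j] by blast
    then have "c = butlast c @ [w0]" using N(1) by (metis append_butlast_last_id last_ConsR list.size(3) not_one_le_zero)
    then have "drop (N - 1) (c @ w') = w"
      by (metis append.assoc append_Cons append_Nil append_eq_conv_conj c(1) length_butlast w')
    moreover have "path_weight P j (c @ w') > 0"
      using c w(1) path_weight_pos_iff[OF wS] by (simp add: path_weight_append w')
    moreover have "c @ w' \<in> words S T" using c wS by (auto simp: words_def T_def)
    ultimately show ?thesis by blast
  qed
  then obtain h where h: "\<And>j. j \<in> S \<Longrightarrow> h j \<in> words S T" "\<And>j. j \<in> S \<Longrightarrow> drop (N - 1) (h j) = w"
    "\<And>j. j \<in> S \<Longrightarrow> path_weight P j (h j) > 0" by metis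
  define d where "d = Min ((\<lambda>j. path_weight P j (h j)) ` S)"
  have S0: "S \<noteq> {}" using wS(1) by blast
  have "d \<in> (\<lambda>j. path_weight P j (h j)) ` S" unfolding d_def using S0 by (intro Min_in) auto
  then have d0: "d > 0" using h(3) by auto
  have d: "d \<le> path_weight P j (h j)" if "j \<in> S" for j
    unfolding d_def using that by (intro Min_le) auto
  define B where "B = {b \<in> words S T. drop (N - 1) b \<noteq> w}"
  have fin: "finite (words S T)" by (rule finite_words) simp
  have B: "(\<Sum>b\<in>B. path_weight P j b) \<le> 1 - d" if j: "j \<in> S" for j
  proof -
    have "(\<Sum>b\<in>insert (h j) B. path_weight P j b) \<le> (\<Sum>b\<in>words S T. path_weight P j b)"
      using h(1)[OF j] fin j by (intro sum_mono2) (auto simp: B_def words_def intro!: path_weight_nonneg)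
    moreover have "h j \<notin> B" "finite B" using h(2)[OF j] fin by (auto simp: B_def)
    ultimately have "path_weight P j (h j) + (\<Sum>b\<in>B. path_weight P j b) \<le> 1"
      using path_weight_total[OF j] by simp
    with d[OF j] show ?thesis by simp
  qed
  have Bw: "B \<subseteq> words S T" by (auto simp: B_def)
  have d1: "1 - d \<ge> 0"
  proof -
    obtain j where j: "j \<in> S" using S0 by blast
    have "0 \<le> (\<Sum>b\<in>B. path_weight P j b)"
      using Bw j by (intro sum_nonneg path_weight_nonneg) (auto simp: words_def)
    with B[OF j] show ?thesis by simp
  qed
  \<comment> \<open>Letter 0 is left free and serves as the starting state; the \<open>n\<close>
    blocks occupy coordinates 1 to \<open>n * T\<close>.\<close>
  define U where "U n = (\<Union>(j, r)\<in>S \<times> blocks B n. cyl 0 (j # r))" for n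
  have finB: "finite (blocks B n)" for n using finite_subset[OF Bw fin] by (rule finite_blocks)
  have U_sets: "U n \<in> sets \<mu>" for n unfolding U_def using finB[of n] by (intro sets.finite_UN) auto
  have U: "prob (U n) \<le> (1 - d) ^ n" for n
  proof -
    have "prob (U n) \<le> (\<Sum>x\<in>S \<times> blocks B n. prob (case x of (j, r) \<Rightarrow> cyl 0 (j # r)))"
      unfolding U_def using finB[of n] by (intro finite_measure_subadditive_finite) auto
    also have "\<dots> = (\<Sum>(j, r)\<in>S \<times> blocks B n. q j * path_weight P j r)"
    proof (rule sum.cong[OF refl])
      fix x assume x: "x \<in> S \<times> blocks B n"
      obtain j r where "x = (j, r)" by (cases x)
      then show "prob (case x of (j, r) \<Rightarrow> cyl 0 (j # r)) = (case x of (j, r) \<Rightarrow> q j * path_weight P j r)"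
        using x measure_cyl[of j r 0] blocks_words[OF Bw, of r n] by auto
    qed
    also have "\<dots> = (\<Sum>j\<in>S. q j * (\<Sum>r\<in>blocks B n. path_weight P j r))"
      by (simp add: sum.cartesian_product[symmetric] sum_distrib_left)
    also have "\<dots> \<le> (\<Sum>j\<in>S. q j * (1 - d) ^ n)"
      using blocks_weight[OF Bw B d1] q_nonneg by (intro sum_mono mult_left_mono)
    also have "\<dots> = (1 - d) ^ n" unfolding sum_distrib_right[symmetric] q_sum by simp
    finally show ?thesis .
  qed
  have "prob (\<Inter>n. U n) \<le> (1 - d) ^ n" for n
    using finite_measure_mono[of "\<Inter>n. U n" "U n"] U[of n] U_sets by (metis Inter_lower order_trans rangeI)
  moreover have "(\<lambda>n. (1 - d) ^ n) \<longlonglongrightarrow> 0" using d0 d1 by (intro LIMSEQ_realpow_zero) auto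
  ultimately have "prob (\<Inter>n. U n) \<le> 0" by (intro LIMSEQ_le_const[of _ 0]) auto
  then have "prob (\<Inter>n. U n) = 0" by (simp add: measure_le_0_iff)
  then have "(\<Inter>n. U n) \<in> null_sets \<mu>"
    using U_sets by (intro null_setsI) (auto simp: emeasure_eq_measure)
  then have "AE \<omega> in \<mu>. \<omega> \<notin> (\<Inter>n. U n)" by (rule AE_not_in)
  then show ?thesis using letters_AE AE_space
  proof eventually_elim
    case (elim \<omega>)
    show ?case
    proof (rule ccontr)
      assume no: "\<not> ?thesis"
      have "seg \<omega> (1 + int a) (n * T) \<in> blocks B n" for n a
      proof (induction n arbitrary: a)
        case (Suc n)
        have "drop (N - 1) (seg \<omega> (1 + int a) T) = seg \<omega> (1 + int (a + (N - 1))) (length w)"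
        proof -
          have "T = (N - 1) + length w" using N(1) by (simp add: T_def w')
          then show ?thesis using seg_add[of \<omega> "1 + int a" "N - 1" "length w"] by (simp add: add.assoc)
        qed
        also have "\<dots> \<noteq> w" using no by blast
        finally have "seg \<omega> (1 + int a) T \<in> B" using elim seg_words[of \<omega> S] by (simp add: B_def)
        moreover have "seg \<omega> (1 + int (a + T)) (n * T) \<in> blocks B n" by (rule Suc)
        moreover have "seg \<omega> (1 + int a) (Suc n * T) = seg \<omega> (1 + int a) T @ seg \<omega> (1 + int (a + T)) (n * T)"
          using seg_add[of \<omega> "1 + int a" T "n * T"] by (simp add: add.assoc)
        ultimately show ?case by force
      qed simp
      then have "seg \<omega> 1 (n * T) \<in> blocks B n" for n by (metis add_0_right of_nat_0)
      then have "\<omega> \<in> U n" for n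
        using elim seg_Suc_Cons[of \<omega> 0 "n * T"] unfolding U_def cyl_def by force
      with elim show False by blast
    qed
  qed
qed

text \<open>The null word occurs almost surely, and from then on every iterate is 0, whose extended
  logarithm is \<open>- \<infinity>\<close>.\<close>

lemma lyap1_eq_minus_infinity:
  assumes w: "adm S step w" and 0: "wprod A w = 0"
  shows "lyap1 \<mu> A = - \<infinity>"
proof -
  have "mat 1 \<noteq> (0 :: real^2^2)" by (metis det_I det_0 mat_0 zero_neq_one)
  then have "w \<noteq> []" using 0 by auto
  have lim: "AE \<omega> in \<mu>. (\<lambda>n. elog (mnorm (cocycle_iter A \<omega> n)) / ereal (real n)) \<longlonglongrightarrow> - \<infinity>"
    using word_occurs_AE[OF w \<open>w \<noteq> []\<close>]
  proof eventually_elim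
    case (elim \<omega>)
    then obtain a where a: "seg \<omega> (1 + int a) (length w) = w" by blast
    have "elog (mnorm (cocycle_iter A \<omega> n)) / ereal (real n) = - \<infinity>" if n: "n \<ge> a + length w" for n
    proof -
      obtain m where m: "n = a + length w + m" using n le_Suc_ex by blast
      have "seg \<omega> 1 n = seg \<omega> 1 a @ w @ seg \<omega> (1 + int (a + length w)) m"
        unfolding m seg_add by (simp add: a)
      then have "cocycle_iter A \<omega> n = 0" by (simp add: cocycle_iter_wprod wprod_append 0)
      moreover have "n > 0" using n \<open>w \<noteq> []\<close> by (cases w) auto
      ultimately show ?thesis by (simp add: mnorm_def elog_def onorm_zero)
    qed
    then have "eventually (\<lambda>n. elog (mnorm (cocycle_iter A \<omega> n)) / ereal (real n) = - \<infinity>) sequentially"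
      by (auto simp: eventually_sequentially)
    then show ?case by (rule tendsto_eventually)
  qed
  show ?thesis unfolding lyap1_def
  proof (rule the_equality)
    show "AE \<omega> in \<mu>. (\<lambda>n. elog (mnorm (cocycle_iter A \<omega> n)) / ereal (real n)) \<longlonglongrightarrow> - \<infinity>"
      by (rule lim)
  next
    fix c assume "AE \<omega> in \<mu>. (\<lambda>n. elog (mnorm (cocycle_iter A \<omega> n)) / ereal (real n)) \<longlonglongrightarrow> c"
    \<comment> \<open>A constant limit is unique because a set of full measure is nonempty in a
      probability space.\<close>
    then have "AE \<omega> in \<mu>. c = - \<infinity>" using lim by eventually_elim (rule LIMSEQ_unique)
    then show "c = - \<infinity>" by simp
  qed
qed

end

section \<open>The Bernoulli case and the dichotomy\<close>

lemma bernoulli_is_markov: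
  assumes "bernoulli_shift k p X \<mu>" shows "markov_shift k (\<lambda>i j. p i) p X \<mu>"
proof -
  have p: "\<And>i. i \<in> {1..k} \<Longrightarrow> p i > 0" "(\<Sum>i\<in>{1..k}. p i) = 1"
    using assms by (simp_all add: bernoulli_shift_def)
  \<comment> \<open>All columns of the transition matrix equal \<open>p\<close>, so its first power
    is already positive.\<close>
  have "mat_pow_entry k (\<lambda>i j. p i) 1 i j = p i" if "j \<in> {1..k}" for i j
    using that by (simp add: if_distrib cong: if_cong)
  then have "primitive_matrix k (\<lambda>i j. p i)"
    unfolding primitive_matrix_def using p by (auto simp: less_imp_le intro!: exI[of _ 1])
  moreover have "(\<Prod>l\<in>{0..n}. p (w l)) = p (w 0) * (\<Prod>l\<in>{1..n}. p (w l))" for n and w :: "nat \<Rightarrow> nat"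
    by (simp add: prod.atLeast_Suc_atMost)
  moreover have "(\<Sum>j\<in>{1..k}. p i * p j) = p i" for i
    using p(2) by (simp add: sum_distrib_left[symmetric])
  ultimately show ?thesis
    using assms p by (auto simp: bernoulli_shift_def markov_shift_def less_imp_le)
qed

theorem theorem1p1:
  fixes k :: nat and p :: "nat \<Rightarrow> real" and P :: "nat \<Rightarrow> nat \<Rightarrow> real" and q :: "nat \<Rightarrow> real"
    and X :: "(int \<Rightarrow> nat) set" and \<mu> :: "(int \<Rightarrow> nat) measure"
    and A :: "nat \<Rightarrow> real^2^2"
  assumes base: "bernoulli_shift k p X \<mu> \<or> markov_shift k P q X \<mu>"
    and matplus: "\<forall>i\<in>{1..k}. det (A i) \<ge> 0"
    and sing: "\<exists>i\<in>{1..k}. det (A i) = 0"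
    and inv: "\<exists>j\<in>{1..k}. det (A j) \<noteq> 0"
  shows "proj_unif_hyp X A \<or>
    (\<exists>An :: nat \<Rightarrow> nat \<Rightarrow> real^2^2.
        (\<forall>n. \<forall>i\<in>{1..k}. det (An n i) \<ge> 0) \<and>
        (\<forall>i\<in>{1..k}. (\<lambda>n. An n i) \<longlonglongrightarrow> A i) \<and>
        (\<forall>n. lyap1 \<mu> (An n) = - \<infinity>))"
proof (rule disj_imp[THEN iffD2], rule impI)
  assume nh: "\<not> proj_unif_hyp X A"
  obtain P q where "markov_shift k P q X \<mu>" using base bernoulli_is_markov by blast
  then interpret markov k P q X \<mu> by unfold_locales
  have "\<exists>\<theta> w. \<bar>\<theta>\<bar> \<le> \<epsilon> \<and> adm S step w \<and> wprod (\<lambda>i. rot \<theta> ** A i) w = 0" if "0 < \<epsilon>" "\<epsilon> < pi / 2" for \<epsilon>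
  proof (rule ccontr)
    assume no: "\<not> ?thesis"
    \<comment> \<open>Without a null word at scale \<open>\<epsilon>\<close> the cocycle would be
      hyperbolic on \<open>subshift\<close>, which is \<open>X\<close>.\<close>
    interpret robustly_nonnull S step A \<epsilon>
      using matplus sing no that step_connected by unfold_locales (auto simp: S_def)
    have "subshift = X" by (simp add: subshift_def X_eq)
    then show False using uniformly_hyperbolic nh by simp
  qed
  \<comment> \<open>Scales tending to 0 and admissible for the preceding fact, as they never exceed
    1.\<close>
  moreover have "1 / real (Suc n) < pi / 2" for n
    using pi_gt3 by (simp add: field_simps) (smt (verit) mult_nonneg_nonneg of_nat_0_le_iff)
  ultimately have "\<exists>\<theta> w. \<bar>\<theta>\<bar> \<le> 1 / real (Suc n) \<and> adm S step w \<and> wprod (\<lambda>i. rot \<theta> ** A i) w = 0" for n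
    by simp
  then obtain \<theta> w where th: "\<And>n. \<bar>\<theta> n\<bar> \<le> 1 / real (Suc n)"
    and w: "\<And>n. adm S step (w n)" "\<And>n. wprod (\<lambda>i. rot (\<theta> n) ** A i) (w n) = 0" by metis
  have "\<theta> \<longlonglongrightarrow> 0"
    by (rule tendsto_rabs_zero_cancel, rule tendsto_sandwich[OF _ _ tendsto_const LIMSEQ_inverse_real_of_nat])
      (use th in \<open>auto simp: inverse_eq_divide\<close>)
  then have cs: "(\<lambda>n. cos (\<theta> n)) \<longlonglongrightarrow> 1" "(\<lambda>n. sin (\<theta> n)) \<longlonglongrightarrow> 0"
    using tendsto_cos[of \<theta> 0 sequentially] tendsto_sin[of \<theta> 0 sequentially] by simp_all
  have R: "(\<lambda>n. rot (\<theta> n)) \<longlonglongrightarrow> mat 1"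
  proof (intro vec_tendstoI)
    show "(\<lambda>n. rot (\<theta> n) $ a $ b) \<longlonglongrightarrow> mat 1 $ a $ b" for a b
      using cs tendsto_minus[OF cs(2)] exhaust_2[of a] exhaust_2[of b] by (auto simp: mat_def)
  qed
  have "(\<lambda>n. rot (\<theta> n) ** A i) \<longlonglongrightarrow> mat 1 ** A i" for i
    unfolding matrix_matrix_mult_def by (intro tendsto_vec_lambda tendsto_intros R)
  then have "(\<lambda>n. rot (\<theta> n) ** A i) \<longlonglongrightarrow> A i" for i by simp
  moreover have "lyap1 \<mu> (\<lambda>i. rot (\<theta> n) ** A i) = - \<infinity>" for n
    by (rule lyap1_eq_minus_infinity[OF w])
  ultimately show "\<exists>An :: nat \<Rightarrow> nat \<Rightarrow> real^2^2.
        (\<forall>n. \<forall>i\<in>{1..k}. det (An n i) \<ge> 0) \<and>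
        (\<forall>i\<in>{1..k}. (\<lambda>n. An n i) \<longlonglongrightarrow> A i) \<and>
        (\<forall>n. lyap1 \<mu> (An n) = - \<infinity>)"
    \<comment> \<open>Rotations have determinant 1, so nonnegativity of the determinants is
      preserved.\<close>
    using matplus by (intro exI[of _ "\<lambda>n i. rot (\<theta> n) ** A i"]) (auto simp: det_mul)
qed

end
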